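(* Let $3\leq d_A\leq d_B\leq d_C$ be integers and consider $\mathbb{C}^{d_A}\otimes\mathbb{C}^{d_B}\otimes\mathbb{C}^{d_C}$. For any integer $n$ with $0\leq n\leq\lfloor (d_A-3)/2\rfloor$, the set $\mathcal{U}_n=\bigcup_{t=0}^{n}\Big(\bigcup_{i=1}^{3}(\mathcal{A}_i^{(t)}\cup\mathcal{B}_i^{(t)})\Big)\cup\mathcal{F}^{(n)}\cup\{|S\rangle\}$ defined in the context is a strongly nonlocal unextendible product basis of size $d_Ad_Bd_C-8(n+1)$.
   Context: $\{|0\rangle,\dots,|d_X-1\rangle\}$ is the computational basis of party $X\in\{A,B,C\}$, $\mathbb{Z}_m=\{0,1,\dots,m-1\}$, $w_m=e^{2\pi\sqrt{-1}/m}$. For an integer $t\ge 0$ and $X\in\{A,B,C\}$ let $X_t=d_X-2t$, and define $|\eta_s^{(t)}\rangle_X=\sum_{r=t}^{X_t+t-2}w_{X_t-1}^{s(r-t)}|r\rangle_X$ and $|\xi_s^{(t)}\rangle_X=\sum_{r=t}^{X_t+t-2}w_{X_t-1}^{s(r-t)}|r+1\rangle_X$ for $s\in\mathbb{Z}_{X_t-1}$, and $|\beta_s^{(t)}\rangle_X=\sum_{r=t}^{X_t+t-3}w_{X_t-2}^{s(r-t)}|r+1\rangle_X$ for $s\in\mathbb{Z}_{X_t-2}$. Define $\mathcal{A}_1^{(t)}=\{|\xi_i^{(t)}\rangle_A|t\rangle_B|\eta_k^{(t)}\rangle_C:(i,k)\in\mathbb{Z}_{A_t-1}\times\mathbb{Z}_{C_t-1}\setminus\{(0,0)\}\}$,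 $\mathcal{A}_2^{(t)}=\{|\xi_i^{(t)}\rangle_A|\eta_j^{(t)}\rangle_B|d_C-1-t\rangle_C:(i,j)\in\mathbb{Z}_{A_t-1}\times\mathbb{Z}_{B_t-1}\setminus\{(0,0)\}\}$, $\mathcal{A}_3^{(t)}=\{|d_A-1-t\rangle_A|\xi_j^{(t)}\rangle_B|\eta_k^{(t)}\rangle_C:(j,k)\in\mathbb{Z}_{B_t-1}\times\mathbb{Z}_{C_t-1}\setminus\{(0,0)\}\}$, $\mathcal{B}_1^{(t)}=\{|\eta_i^{(t)}\rangle_A|d_B-1-t\rangle_B|\xi_k^{(t)}\rangle_C:(i,k)\in\mathbb{Z}_{A_t-1}\times\mathbb{Z}_{C_t-1}\setminus\{(0,0)\}\}$, $\mathcal{B}_2^{(t)}=\{|\eta_i^{(t)}\rangle_A|\xi_j^{(t)}\rangle_B|t\rangle_C:(i,j)\in\mathbb{Z}_{A_t-1}\times\mathbb{Z}_{B_t-1}\setminus\{(0,0)\}\}$, $\mathcal{B}_3^{(t)}=\{|t\rangle_A|\eta_j^{(t)}\rangle_B|\xi_k^{(t)}\rangle_C:(j,k)\in\mathbb{Z}_{B_t-1}\times\mathbb{Z}_{C_t-1}\setminus\{(0,0)\}\}$, $\mathcal{F}^{(t)}=\{|\beta_i^{(t)}\rangle_A|\beta_j^{(t)}\rangle_B|\beta_k^{(t)}\rangle_C:(i,j,k)\in\mathbb{Z}_{A_t-2}\times\mathbb{Z}_{B_t-2}\times\mathbb{Z}_{C_t-2}\setminus\{(0,0,0)\}\}$,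 and $|S\rangle=(\sum_{i=0}^{d_A-1}|i\rangle)_A(\sum_{j=0}^{d_B-1}|j\rangle)_B(\sum_{k=0}^{d_C-1}|k\rangle)_C$. States are unnormalized. An unextendible product basis (UPB) is a set of mutually orthogonal product states, not spanning the whole space, whose orthogonal complement contains no product state. A local measurement (POVM) on a set of mutually orthogonal states is orthogonality-preserving if the post-measurement states remain mutually orthogonal; a set of orthogonal states is locally irreducible if it is not possible to eliminate one or more states from the set by orthogonality-preserving local measurements; a tripartite orthogonal product set is strongly nonlocal if it is locally irreducible in every bipartition $A|BC$, $B|CA$, $C|AB$. *)

theory Defs
  imports Complex_Main
begin

definition ket :: "nat \<Rightarrow> nat \<Rightarrow> complex" where
  "ket r = (\<lambda>x. if x = r then 1 else 0)"

definition ones :: "nat \<Rightarrow> nat \<Rightarrow> complex" where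
  "ones d = (\<lambda>x. if x < d then 1 else 0)"

definition omega :: "nat \<Rightarrow> complex" where
  "omega m = cis (2 * pi / real m)"

text \<open>eta_s^(t) for a party of dimension d, with X_t = d - 2t (sum over r = t .. X_t + t - 2)\<close>
definition eta :: "nat \<Rightarrow> nat \<Rightarrow> nat \<Rightarrow> nat \<Rightarrow> complex" where
  "eta d t s = (\<lambda>x. \<Sum>r\<in>{t..(d - 2*t) + t - 2}. omega (d - 2*t - 1) ^ (s * (r - t)) * ket r x)"

definition xi :: "nat \<Rightarrow> nat \<Rightarrow> nat \<Rightarrow> nat \<Rightarrow> complex" where
  "xi d t s = (\<lambda>x. \<Sum>r\<in>{t..(d - 2*t) + t - 2}. omega (d - 2*t - 1) ^ (s * (r - t)) * ket (r + 1) x)"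

definition beta :: "nat \<Rightarrow> nat \<Rightarrow> nat \<Rightarrow> nat \<Rightarrow> complex" where
  "beta d t s = (\<lambda>x. \<Sum>r\<in>{t..(d - 2*t) + t - 3}. omega (d - 2*t - 2) ^ (s * (r - t)) * ket (r + 1) x)"

definition tensor3 :: "(nat \<Rightarrow> complex) \<Rightarrow> (nat \<Rightarrow> complex) \<Rightarrow> (nat \<Rightarrow> complex) \<Rightarrow> nat \<Rightarrow> nat \<Rightarrow> nat \<Rightarrow> complex" where
  "tensor3 a b c = (\<lambda>i j k. a i * b j * c k)"

definition in_space :: "nat \<Rightarrow> nat \<Rightarrow> nat \<Rightarrow> (nat \<Rightarrow> nat \<Rightarrow> nat \<Rightarrow> complex) \<Rightarrow> bool" where
  "in_space dA dB dC v \<longleftrightarrow> (\<forall>i j k. \<not> (i < dA \<and> j < dB \<and> k < dC) \<longrightarrow> v i j k = 0)"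

definition inner3 :: "nat \<Rightarrow> nat \<Rightarrow> nat \<Rightarrow> (nat \<Rightarrow> nat \<Rightarrow> nat \<Rightarrow> complex) \<Rightarrow> (nat \<Rightarrow> nat \<Rightarrow> nat \<Rightarrow> complex) \<Rightarrow> complex" where
  "inner3 dA dB dC u v = (\<Sum>i<dA. \<Sum>j<dB. \<Sum>k<dC. cnj (u i j k) * v i j k)"

definition is_product3 :: "nat \<Rightarrow> nat \<Rightarrow> nat \<Rightarrow> (nat \<Rightarrow> nat \<Rightarrow> nat \<Rightarrow> complex) \<Rightarrow> bool" where
  "is_product3 dA dB dC v \<longleftrightarrow>
     (\<exists>a b c. (\<forall>i\<ge>dA. a i = 0) \<and> (\<forall>j\<ge>dB. b j = 0) \<and> (\<forall>k\<ge>dC. c k = 0) \<and> v = tensor3 a b c)"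

definition cspan3 :: "(nat \<Rightarrow> nat \<Rightarrow> nat \<Rightarrow> complex) set \<Rightarrow> (nat \<Rightarrow> nat \<Rightarrow> nat \<Rightarrow> complex) set" where
  "cspan3 S = {v. \<exists>F c. finite F \<and> F \<subseteq> S \<and> v = (\<lambda>i j k. \<Sum>\<psi>\<in>F. c \<psi> * \<psi> i j k)}"

definition mutually_orthogonal3 :: "nat \<Rightarrow> nat \<Rightarrow> nat \<Rightarrow> (nat \<Rightarrow> nat \<Rightarrow> nat \<Rightarrow> complex) set \<Rightarrow> bool" where
  "mutually_orthogonal3 dA dB dC S \<longleftrightarrow> (\<forall>\<psi>\<in>S. \<forall>\<phi>\<in>S. \<psi> \<noteq> \<phi> \<longrightarrow> inner3 dA dB dC \<psi> \<phi> = 0)"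

definition UPB :: "nat \<Rightarrow> nat \<Rightarrow> nat \<Rightarrow> (nat \<Rightarrow> nat \<Rightarrow> nat \<Rightarrow> complex) set \<Rightarrow> bool" where
  "UPB dA dB dC S \<longleftrightarrow>
     (\<forall>\<psi>\<in>S. is_product3 dA dB dC \<psi> \<and> \<psi> \<noteq> (\<lambda>i j k. 0)) \<and>
     mutually_orthogonal3 dA dB dC S \<and>
     \<not> ({v. in_space dA dB dC v} \<subseteq> cspan3 S) \<and>
     \<not> (\<exists>v. is_product3 dA dB dC v \<and> v \<noteq> (\<lambda>i j k. 0) \<and> (\<forall>\<psi>\<in>S. inner3 dA dB dC \<psi> v = 0))"

definition psd_on :: "'a set \<Rightarrow> ('a \<Rightarrow> 'a \<Rightarrow> complex) \<Rightarrow> bool" where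
  "psd_on I E \<longleftrightarrow> (\<forall>v. let q = (\<Sum>x\<in>I. \<Sum>x'\<in>I. cnj (v x) * E x x' * v x') in Im q = 0 \<and> Re q \<ge> 0)"

definition povm :: "'a set \<Rightarrow> nat set \<Rightarrow> (nat \<Rightarrow> 'a \<Rightarrow> 'a \<Rightarrow> complex) \<Rightarrow> bool" where
  "povm I M E \<longleftrightarrow> finite M \<and> (\<forall>m\<in>M. psd_on I (E m)) \<and>
     (\<forall>x\<in>I. \<forall>x'\<in>I. (\<Sum>m\<in>M. E m x x') = (if x = x' then 1 else 0))"

definition elem_left :: "'a set \<Rightarrow> 'b set \<Rightarrow> ('a \<Rightarrow> 'a \<Rightarrow> complex) \<Rightarrow> ('a \<Rightarrow> 'b \<Rightarrow> complex) \<Rightarrow> ('a \<Rightarrow> 'b \<Rightarrow> complex) \<Rightarrow> complex" where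
  "elem_left I J E \<psi> \<phi> = (\<Sum>x\<in>I. \<Sum>x'\<in>I. \<Sum>y\<in>J. cnj (\<psi> x y) * E x x' * \<phi> x' y)"

definition OP_meas_left :: "'a set \<Rightarrow> 'b set \<Rightarrow> ('a \<Rightarrow> 'b \<Rightarrow> complex) set \<Rightarrow> nat set \<Rightarrow> (nat \<Rightarrow> 'a \<Rightarrow> 'a \<Rightarrow> complex) \<Rightarrow> bool" where
  "OP_meas_left I J S M E \<longleftrightarrow> povm I M E \<and>
     (\<forall>m\<in>M. \<forall>\<psi>\<in>S. \<forall>\<phi>\<in>S. \<psi> \<noteq> \<phi> \<longrightarrow> elem_left I J (E m) \<psi> \<phi> = 0)"

text \<open>The measurement eliminates one or more states: for some (occurring) outcome some state
  of the set has post-measurement probability zero.\<close>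
definition eliminates_left :: "'a set \<Rightarrow> 'b set \<Rightarrow> ('a \<Rightarrow> 'b \<Rightarrow> complex) set \<Rightarrow> nat set \<Rightarrow> (nat \<Rightarrow> 'a \<Rightarrow> 'a \<Rightarrow> complex) \<Rightarrow> bool" where
  "eliminates_left I J S M E \<longleftrightarrow>
     (\<exists>m\<in>M. (\<exists>\<psi>\<in>S. elem_left I J (E m) \<psi> \<psi> = 0) \<and> (\<exists>\<phi>\<in>S. elem_left I J (E m) \<phi> \<phi> \<noteq> 0))"

definition irreducible_left :: "'a set \<Rightarrow> 'b set \<Rightarrow> ('a \<Rightarrow> 'b \<Rightarrow> complex) set \<Rightarrow> bool" where
  "irreducible_left I J S \<longleftrightarrow>
     (\<forall>(M :: nat set) E. OP_meas_left I J S M E \<longrightarrow> \<not> eliminates_left I J S M E)"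

definition locally_irreducible :: "'a set \<Rightarrow> 'b set \<Rightarrow> ('a \<Rightarrow> 'b \<Rightarrow> complex) set \<Rightarrow> bool" where
  "locally_irreducible I J S \<longleftrightarrow>
     irreducible_left I J S \<and> irreducible_left J I ((\<lambda>\<psi> y x. \<psi> x y) ` S)"

definition strongly_nonlocal :: "nat \<Rightarrow> nat \<Rightarrow> nat \<Rightarrow> (nat \<Rightarrow> nat \<Rightarrow> nat \<Rightarrow> complex) set \<Rightarrow> bool" where
  "strongly_nonlocal dA dB dC S \<longleftrightarrow>
     mutually_orthogonal3 dA dB dC S \<and>
     locally_irreducible {..<dA} ({..<dB} \<times> {..<dC}) ((\<lambda>\<psi> i (j, k). \<psi> i j k) ` S) \<and>
     locally_irreducible {..<dB} ({..<dC} \<times> {..<dA}) ((\<lambda>\<psi> j (k, i). \<psi> i j k) ` S) \<and>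
     locally_irreducible {..<dC} ({..<dA} \<times> {..<dB}) ((\<lambda>\<psi> k (i, j). \<psi> i j k) ` S)"

definition setA1 where
  "setA1 dA dB dC t = {tensor3 (xi dA t i) (ket t) (eta dC t k) | i k.
      i < dA - 2*t - 1 \<and> k < dC - 2*t - 1 \<and> (i, k) \<noteq> (0, 0)}"
definition setA2 where
  "setA2 dA dB dC t = {tensor3 (xi dA t i) (eta dB t j) (ket (dC - 1 - t)) | i j.
      i < dA - 2*t - 1 \<and> j < dB - 2*t - 1 \<and> (i, j) \<noteq> (0, 0)}"
definition setA3 where
  "setA3 dA dB dC t = {tensor3 (ket (dA - 1 - t)) (xi dB t j) (eta dC t k) | j k.
      j < dB - 2*t - 1 \<and> k < dC - 2*t - 1 \<and> (j, k) \<noteq> (0, 0)}"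
definition setB1 where
  "setB1 dA dB dC t = {tensor3 (eta dA t i) (ket (dB - 1 - t)) (xi dC t k) | i k.
      i < dA - 2*t - 1 \<and> k < dC - 2*t - 1 \<and> (i, k) \<noteq> (0, 0)}"
definition setB2 where
  "setB2 dA dB dC t = {tensor3 (eta dA t i) (xi dB t j) (ket t) | i j.
      i < dA - 2*t - 1 \<and> j < dB - 2*t - 1 \<and> (i, j) \<noteq> (0, 0)}"
definition setB3 where
  "setB3 dA dB dC t = {tensor3 (ket t) (eta dB t j) (xi dC t k) | j k.
      j < dB - 2*t - 1 \<and> k < dC - 2*t - 1 \<and> (j, k) \<noteq> (0, 0)}"
definition setF where
  "setF dA dB dC t = {tensor3 (beta dA t i) (beta dB t j) (beta dC t k) | i j k.
      i < dA - 2*t - 2 \<and> j < dB - 2*t - 2 \<and> k < dC - 2*t - 2 \<and> (i, j, k) \<noteq> (0, 0, 0)}"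
definition stopper where
  "stopper dA dB dC = tensor3 (ones dA) (ones dB) (ones dC)"

definition setU :: "nat \<Rightarrow> nat \<Rightarrow> nat \<Rightarrow> nat \<Rightarrow> (nat \<Rightarrow> nat \<Rightarrow> nat \<Rightarrow> complex) set" where
  "setU dA dB dC n =
     (\<Union>t\<in>{0..n}. setA1 dA dB dC t \<union> setA2 dA dB dC t \<union> setA3 dA dB dC t \<union>
                  setB1 dA dB dC t \<union> setB2 dA dB dC t \<union> setB3 dA dB dC t)
     \<union> setF dA dB dC n \<union> {stopper dA dB dC}"

end

(* The tensor grid is cut into concentric shells, each of which, apart from its two opposite
   corners, is tiled by six slabs arranged as a pinwheel; the innermost box is the core. The states
   of a slab or of the core are the nontrivial Fourier modes of that box, so being orthogonal to all
   of them means being constant on the box. A product vector that is constant on all boxes and has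
   entry sum zero is peeled shell by shell down to the core and vanishes.

   For strong nonlocality only the outermost shell and the stopper are needed. Let E be an effect on
   two of the parties that preserves orthogonality. The projections of the four slabs that are long
   in the remaining party tile the boundary of the two-party grid; orthogonality of states from
   different boxes kills all entries of E between different tiles, and the stopper makes the row sums
   of E constant. Each of the other two slabs projects onto a rectangle covering the grid up to two
   adjacent sides, and on such a rectangle E is a convolution kernel up to row and column terms. The
   vanishing entries then force E to be a multiple of the identity. *)

theory Submission
  imports Defs
begin

section \<open>Fourier vectors and boxes\<close>

text \<open>Every box lacks its constant mode, so a form W tested on two boxes is never seen entry
  by entry, but only through mixed differences W p p' - W q p' - W p q' + W q q'. This obstacle
  shapes the nonlocality part. For two different boxes such a difference vanishes and can be made to
  collapse to one or two entries of E, because an effect on two parties is diagonal in the remaining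
  coordinate. Within a slab that is flat in the remaining party, distinct nontrivial modes are
  orthogonal with respect to E; this makes E a function of the displacement up to a row and a column
  term, which the constant row and column sums remove. The function is periodic with the side
  lengths of the rectangle, so every nonzero displacement inside a tile also occurs, modulo these
  periods, between two tiles, where E vanishes.

  The 8 in the size: each shell leaves two corners uncovered and loses six constant modes. The mode
  missing in the core is made up for by the stopper.\<close>

definition fvec :: "nat \<Rightarrow> nat \<Rightarrow> nat \<Rightarrow> nat \<Rightarrow> complex" where
  "fvec lo m s x = (if lo \<le> x \<and> x < lo + m then omega m ^ (s * (x - lo)) else 0)"

text \<open>A geometric sum. The index r may be read as a position or as a frequency, which gives
  the orthogonality \<open>fvec_orth\<close> and the completeness \<open>fvec_complete\<close> of
  the modes.\<close>

lemma sum_omega: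
  assumes "a < m" "b < m"
  shows "(\<Sum>r<m. omega m ^ (r * a) * cnj (omega m ^ (r * b))) = (if a = b then of_nat m else 0)"
proof -
  define z where "z = omega m ^ a * cnj (omega m ^ b)"
  have z: "z = cis (2 * pi * (real a - real b) / real m)"
    unfolding z_def omega_def
    by (simp add: DeMoivre cis_cnj cis_mult field_simps diff_divide_distrib)
  have "(\<Sum>r<m. omega m ^ (r * a) * cnj (omega m ^ (r * b))) = (\<Sum>r<m. z ^ r)"
    by (rule sum.cong) (auto simp: z_def power_mult_distrib power_mult [symmetric] mult.commute)
  also have "\<dots> = (if a = b then of_nat m else 0)"
  proof (cases "a = b")
    case True
    then show ?thesis by (simp add: z)
  next
    case False
    \<comment> \<open>Otherwise m divides a - b, although a and b are distinct and closer than
      m.\<close>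
    have "z \<noteq> 1"
    proof
      assume "z = 1"
      then obtain k :: int where k: "2 * pi * (real a - real b) / real m = 2 * pi * real_of_int k"
        unfolding z by (auto simp: complex_eq_iff cos_one_2pi_int)
      then have "(2 * pi) * (real a - real b) = (2 * pi) * (real_of_int k * real m)"
        using assms by (simp add: divide_eq_eq mult.assoc)
      then have "real a - real b = real_of_int k * real m"
        by (simp only: mult_cancel_left) simp
      then have "real_of_int (int a - int b) = real_of_int (k * int m)" by simp
      then have e: "int a - int b = k * int m" by (simp only: of_int_eq_iff)
      have "\<bar>int a - int b\<bar> < int m" using assms by linarith
      then have "\<bar>k\<bar> * int m < 1 * int m" using e by (simp add: abs_mult)
      then have "k = 0" by (simp only: mult_less_cancel_right) auto
      then show False using e False by simp
    qed
    moreover have "z ^ m = 1"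
    proof -
      have "z ^ m = cis (2 * pi * real_of_int (int a - int b))"
        unfolding z using assms by (simp add: DeMoivre)
      then show ?thesis by (metis Ints_of_int cis_multiple_2pi)
    qed
    ultimately show ?thesis using False by (simp add: sum_gp_strict)
  qed
  finally show ?thesis .
qed

lemma omega_nonzero [simp]: "omega m \<noteq> 0"
  by (simp add: omega_def)

lemma fvec_orth:
  assumes "s < m" "s' < m"
  shows "(\<Sum>x\<in>{lo..<lo+m}. cnj (fvec lo m s x) * fvec lo m s' x) = (if s = s' then of_nat m else 0)"
proof -
  have "(\<Sum>x\<in>{lo..<lo+m}. cnj (fvec lo m s x) * fvec lo m s' x)
      = (\<Sum>r<m. omega m ^ (r * s') * cnj (omega m ^ (r * s)))"
    by (rule sum.reindex_bij_witness [of _ "\<lambda>r. r + lo" "\<lambda>x. x - lo"])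
      (auto simp: fvec_def mult.commute)
  then show ?thesis using sum_omega [OF assms(2,1)] by auto
qed

lemma fvec_complete:
  assumes "x \<in> {lo..<lo+m}" "y \<in> {lo..<lo+m}"
  shows "(\<Sum>s<m. fvec lo m s x * cnj (fvec lo m s y)) = (if x = y then of_nat m else 0)"
  using sum_omega [of "x - lo" m "y - lo"] assms by (auto simp: fvec_def)

text \<open>The bound keeps the truncated subtraction in \<open>eta\<close> faithful: for d = 1 and
  t = 0 the sum would run over {0..0} although its length should be 0. With the lemmas that follow,
  every local factor is an \<open>fvec\<close>; \<open>ket\<close> is a window of length one and
  \<open>ones\<close> a zero frequency.\<close>

lemma eta_fvec: "2 * t + 2 \<le> d \<Longrightarrow> eta d t s = fvec t (d - 2 * t - 1) s"
proof (rule ext)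
  fix x assume "2 * t + 2 \<le> d"
  have "eta d t s x = (\<Sum>r\<in>{t..(d - 2*t) + t - 2}. if r = x then omega (d - 2*t - 1) ^ (s * (r - t)) else 0)"
    unfolding eta_def by (rule sum.cong) (auto simp: ket_def)
  then show "eta d t s x = fvec t (d - 2 * t - 1) s x"
    using \<open>2 * t + 2 \<le> d\<close> by (auto simp: fvec_def)
qed

lemma xi_fvec: "2 * t + 2 \<le> d \<Longrightarrow> xi d t s = fvec (t + 1) (d - 2 * t - 1) s"
proof (rule ext)
  fix x assume "2 * t + 2 \<le> d"
  \<comment> \<open>At x = 0 the truncated x - 1 is 0 and would match r = 0, hence the conjunct 0 <
    x.\<close>
  have "xi d t s x = (\<Sum>r\<in>{t..(d - 2*t) + t - 2}. if r = x - 1 \<and> 0 < x then omega (d - 2*t - 1) ^ (s * (r - t)) else 0)"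
    unfolding xi_def by (rule sum.cong) (auto simp: ket_def)
  then show "xi d t s x = fvec (t + 1) (d - 2 * t - 1) s x"
    using \<open>2 * t + 2 \<le> d\<close> by (cases "0 < x") (auto simp: fvec_def )
qed

lemma beta_fvec: "2 * t + 3 \<le> d \<Longrightarrow> beta d t s = fvec (t + 1) (d - 2 * t - 2) s"
proof (rule ext)
  fix x assume "2 * t + 3 \<le> d"
  have "beta d t s x = (\<Sum>r\<in>{t..(d - 2*t) + t - 3}. if r = x - 1 \<and> 0 < x then omega (d - 2*t - 2) ^ (s * (r - t)) else 0)"
    unfolding beta_def by (rule sum.cong) (auto simp: ket_def)
  then show "beta d t s x = fvec (t + 1) (d - 2 * t - 2) s x"
    using \<open>2 * t + 3 \<le> d\<close> by (cases "0 < x") (auto simp: fvec_def )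
qed

lemma ket_fvec: "ket r = fvec r 1 0"
  by (rule ext) (auto simp: ket_def fvec_def)

lemma ones_fvec: "ones d = fvec 0 d 0"
  by (rule ext) (auto simp: ones_def fvec_def)

section \<open>Boxes of cells and their Fourier states\<close>

type_synonym cell = "nat \<times> nat \<times> nat"
type_synonym box = "(nat \<times> nat) \<times> (nat \<times> nat) \<times> (nat \<times> nat)"

fun cells :: "box \<Rightarrow> cell set" where
  "cells ((a, la), (b, lb), (c, lc)) = {a..<a+la} \<times> {b..<b+lb} \<times> {c..<c+lc}"

fun modes :: "box \<Rightarrow> cell set" where
  "modes ((a, la), (b, lb), (c, lc)) = {..<la} \<times> {..<lb} \<times> {..<lc}"

fun bst :: "box \<Rightarrow> cell \<Rightarrow> nat \<Rightarrow> nat \<Rightarrow> nat \<Rightarrow> complex" where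
  "bst ((a, la), (b, lb), (c, lc)) (i, j, k) = tensor3 (fvec a la i) (fvec b lb j) (fvec c lc k)"

text \<open>Uncurried, so that sums over three parties become sums over one set of cells, which can
  be restricted to a box.\<close>

definition amp :: "(nat \<Rightarrow> nat \<Rightarrow> nat \<Rightarrow> complex) \<Rightarrow> cell \<Rightarrow> complex" where
  "amp \<psi> = (\<lambda>(i, j, k). \<psi> i j k)"

text \<open>The mode (0, 0, 0) is the constant vector on the box. A flat direction has only the
  frequency 0, so on a slab its removal is the removal of the pair (0, 0).\<close>

definition bstates :: "box \<Rightarrow> (nat \<Rightarrow> nat \<Rightarrow> nat \<Rightarrow> complex) set" where
  "bstates \<beta> = bst \<beta> ` (modes \<beta> - {(0, 0, 0)})"

lemma finite_cells [simp]: "finite (cells \<beta>)"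
  by (cases \<beta> rule: cells.cases) simp

lemma finite_modes [simp]: "finite (modes \<beta>)"
  by (cases \<beta> rule: cells.cases) simp

lemma card_modes: "card (modes \<beta>) = card (cells \<beta>)"
  by (cases \<beta> rule: cells.cases) (simp add: card_cartesian_product)

lemma amp_bst_0: "p \<notin> cells \<beta> \<Longrightarrow> amp (bst \<beta> s) p = 0"
  by (cases \<beta> rule: cells.cases; cases s; cases p) (auto simp: amp_def tensor3_def fvec_def)

lemma amp_bst_nz: "p \<in> cells \<beta> \<Longrightarrow> amp (bst \<beta> s) p \<noteq> 0"
  by (cases \<beta> rule: cells.cases; cases s; cases p) (auto simp: amp_def tensor3_def fvec_def)

lemma amp_bst_zero_mode: "p \<in> cells \<beta> \<Longrightarrow> amp (bst \<beta> (0, 0, 0)) p = 1"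
  by (cases \<beta> rule: cells.cases; cases p) (auto simp: amp_def tensor3_def fvec_def)

lemma sum_triple:
  fixes f g h :: "nat \<Rightarrow> complex"
  shows "(\<Sum>(i, j, k)\<in>A \<times> B \<times> C. f i * g j * h k) = sum f A * sum g B * sum h C"
  by (simp add: sum.cartesian_product [symmetric] sum_distrib_left [symmetric]
      sum_distrib_right [symmetric] mult.assoc)

lemma scaled_sum_product:
  fixes f g :: "'a \<Rightarrow> complex"
  shows "c * sum f A * sum g B = (\<Sum>x\<in>A. \<Sum>y\<in>B. c * f x * g y)"
  by (simp only: mult.assoc sum_product) (simp only: sum_distrib_left)

lemma bst_orth:
  assumes "s \<in> modes \<beta>" "s' \<in> modes \<beta>"
  shows "(\<Sum>p\<in>cells \<beta>. cnj (amp (bst \<beta> s) p) * amp (bst \<beta> s') p)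
    = (if s = s' then of_nat (card (cells \<beta>)) else 0)"
proof -
  obtain a la b lb c lc where \<beta>: "\<beta> = ((a, la), (b, lb), (c, lc))"
    by (cases \<beta> rule: cells.cases)
  obtain i j k i' j' k' where s: "s = (i, j, k)" "s' = (i', j', k')" by (metis prod_cases3)
  have "(\<Sum>p\<in>cells \<beta>. cnj (amp (bst \<beta> s) p) * amp (bst \<beta> s') p)
    = (\<Sum>(x, y, z)\<in>{a..<a+la} \<times> {b..<b+lb} \<times> {c..<c+lc}.
        (cnj (fvec a la i x) * fvec a la i' x) * (cnj (fvec b lb j y) * fvec b lb j' y)
        * (cnj (fvec c lc k z) * fvec c lc k' z))"
    unfolding \<beta> s by (auto intro!: sum.cong simp: amp_def tensor3_def mult_ac)
  also have "\<dots> = (if s = s' then of_nat (card (cells \<beta>)) else 0)"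
    unfolding sum_triple using assms
    by (auto simp: \<beta> s fvec_orth card_cartesian_product mult.assoc)
  finally show ?thesis .
qed

lemma bst_complete:
  assumes "p \<in> cells \<beta>" "q \<in> cells \<beta>"
  shows "(\<Sum>s\<in>modes \<beta>. amp (bst \<beta> s) p * cnj (amp (bst \<beta> s) q))
    = (if p = q then of_nat (card (cells \<beta>)) else 0)"
proof -
  obtain a la b lb c lc where \<beta>: "\<beta> = ((a, la), (b, lb), (c, lc))"
    by (cases \<beta> rule: cells.cases)
  obtain x y z x' y' z' where s: "p = (x, y, z)" "q = (x', y', z')" by (metis prod_cases3)
  have "(\<Sum>s\<in>modes \<beta>. amp (bst \<beta> s) p * cnj (amp (bst \<beta> s) q))
    = (\<Sum>(i, j, k)\<in>{..<la} \<times> {..<lb} \<times> {..<lc}.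
        (fvec a la i x * cnj (fvec a la i x')) * (fvec b lb j y * cnj (fvec b lb j y'))
        * (fvec c lc k z * cnj (fvec c lc k z')))"
    unfolding \<beta> s by (auto intro!: sum.cong simp: amp_def tensor3_def mult_ac)
  also have "\<dots> = (if p = q then of_nat (card (cells \<beta>)) else 0)"
    unfolding sum_triple using assms
    by (auto simp: \<beta> s fvec_complete card_cartesian_product mult.assoc)
  finally show ?thesis .
qed

text \<open>Fourier inversion: \<open>bst_complete\<close> recovers each value of \<phi> from its
  coefficients. Only the constant mode contributes, so every value times the volume is the total
  sum.\<close>

lemma bst_const:
  assumes ker: "\<And>s. s \<in> modes \<beta> \<Longrightarrow> s \<noteq> (0, 0, 0) \<Longrightarrow> (\<Sum>p\<in>cells \<beta>. amp (bst \<beta> s) p * \<phi> p) = 0"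
    and p: "p \<in> cells \<beta>" and q: "q \<in> cells \<beta>"
  shows "\<phi> p = \<phi> q"
proof -
  let ?V = "of_nat (card (cells \<beta>)) :: complex"
  have *: "?V * \<phi> q = sum \<phi> (cells \<beta>)" if q: "q \<in> cells \<beta>" for q
  proof -
    have z: "(0, 0, 0) \<in> modes \<beta>" using q by (cases \<beta> rule: cells.cases) auto
    have "?V * \<phi> q = (\<Sum>p\<in>cells \<beta>. if p = q then ?V * \<phi> p else 0)"
      using q by (simp add: )
    also have "\<dots> = (\<Sum>p\<in>cells \<beta>. (\<Sum>s\<in>modes \<beta>. amp (bst \<beta> s) p * cnj (amp (bst \<beta> s) q)) * \<phi> p)"
      using q by (intro sum.cong refl) (simp add: bst_complete)
    also have "\<dots> = (\<Sum>s\<in>modes \<beta>. cnj (amp (bst \<beta> s) q) * (\<Sum>p\<in>cells \<beta>. amp (bst \<beta> s) p * \<phi> p))"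
      unfolding sum_distrib_right sum_distrib_left
      by (subst sum.swap) (simp add: mult_ac)
    also have "\<dots> = (\<Sum>s\<in>modes \<beta>. if s = (0, 0, 0) then sum \<phi> (cells \<beta>) else 0)"
      using q ker by (intro sum.cong refl) (auto simp: amp_bst_zero_mode)
    also have "\<dots> = sum \<phi> (cells \<beta>)" using z by (simp add: )
    finally show ?thesis .
  qed
  have "?V \<noteq> 0" using p by (auto simp: card_eq_0_iff)
  then show ?thesis using * [OF p] * [OF q] by (metis mult_left_cancel)
qed

lemma bst_const_cnj:
  assumes ker: "\<And>s. s \<in> modes \<beta> \<Longrightarrow> s \<noteq> (0, 0, 0) \<Longrightarrow> (\<Sum>p\<in>cells \<beta>. cnj (amp (bst \<beta> s) p) * \<phi> p) = 0"
    and p: "p \<in> cells \<beta>" and q: "q \<in> cells \<beta>"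
  shows "\<phi> p = \<phi> q"
proof -
  have "(\<Sum>p\<in>cells \<beta>. amp (bst \<beta> s) p * cnj (\<phi> p)) = 0" if "s \<in> modes \<beta>" "s \<noteq> (0, 0, 0)" for s
    using arg_cong [OF ker [OF that], of cnj] by simp
  from bst_const [OF this p q] show ?thesis by simp
qed

text \<open>Annihilating the nontrivial modes on both sides means that W is a function of p plus a
  function of p'; the mixed difference expresses this without naming them.
  \<open>bst_const_cnj\<close> acts in the first variable and \<open>bst_const\<close> in the
  second.\<close>

lemma bst_double:
  assumes ker: "\<And>s s'. s \<in> modes \<beta> - {(0, 0, 0)} \<Longrightarrow> s' \<in> modes \<beta>' - {(0, 0, 0)} \<Longrightarrow>
      (\<Sum>p\<in>cells \<beta>. \<Sum>p'\<in>cells \<beta>'. cnj (amp (bst \<beta> s) p) * W p p' * amp (bst \<beta>' s') p') = 0"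
    and p: "p \<in> cells \<beta>" "q \<in> cells \<beta>" and p': "p' \<in> cells \<beta>'" "q' \<in> cells \<beta>'"
  shows "W p p' - W q p' - W p q' + W q q' = 0"
proof -
  have "W p p' - W q p' = W p q' - W q q'"
  proof (rule bst_const [OF _ p', where \<phi> = "\<lambda>p'. W p p' - W q p'"])
    fix s' assume s': "s' \<in> modes \<beta>'" "s' \<noteq> (0, 0, 0)"
    have "(\<Sum>p'\<in>cells \<beta>'. W p p' * amp (bst \<beta>' s') p') = (\<Sum>p'\<in>cells \<beta>'. W q p' * amp (bst \<beta>' s') p')"
      by (rule bst_const_cnj [OF _ p])
        (use ker s' in \<open>simp add: sum_distrib_left mult.assoc\<close>)
    then show "(\<Sum>p'\<in>cells \<beta>'. amp (bst \<beta>' s') p' * (W p p' - W q p')) = 0"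
      by (simp add: right_diff_distrib sum_subtractf mult.commute)
  qed
  then show ?thesis by (simp add: algebra_simps)
qed

text \<open>Subtracting the diagonal part L leaves a form to which \<open>bst_double\<close>
  applies. The summand of the constant mode in L is a constant and cancels in the mixed
  difference.\<close>

lemma bst_diagonal:
  assumes ker: "\<And>s s'. s \<in> modes \<beta> - {(0, 0, 0)} \<Longrightarrow> s' \<in> modes \<beta> - {(0, 0, 0)} \<Longrightarrow> s \<noteq> s' \<Longrightarrow>
      (\<Sum>p\<in>cells \<beta>. \<Sum>p'\<in>cells \<beta>. cnj (amp (bst \<beta> s) p) * W p p' * amp (bst \<beta> s') p') = 0"
  obtains l where "\<And>p q p' q'. p \<in> cells \<beta> \<Longrightarrow> q \<in> cells \<beta> \<Longrightarrow> p' \<in> cells \<beta> \<Longrightarrow> q' \<in> cells \<beta> \<Longrightarrow>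
    (let L = \<lambda>p p'. \<Sum>s\<in>modes \<beta>. l s * (amp (bst \<beta> s) p * cnj (amp (bst \<beta> s) p')) in
     W p p' - W q p' - W p q' + W q q' = L p p' - L q p' - L p q' + L q q')"
proof (rule that)
  let ?V = "of_nat (card (cells \<beta>)) :: complex"
  \<comment> \<open>The modes are unnormalized with squared norm V, which enters once for each
    argument.\<close>
  define l where "l s = (\<Sum>p\<in>cells \<beta>. \<Sum>p'\<in>cells \<beta>. cnj (amp (bst \<beta> s) p) * W p p' * amp (bst \<beta> s) p') / ?V\<^sup>2" for s
  define L where "L p p' = (\<Sum>s\<in>modes \<beta>. l s * (amp (bst \<beta> s) p * cnj (amp (bst \<beta> s) p')))" for p p'
  fix p q p' q' assume c: "p \<in> cells \<beta>" "q \<in> cells \<beta>" "p' \<in> cells \<beta>" "q' \<in> cells \<beta>"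
  have V: "?V \<noteq> 0" using c by (auto simp: card_eq_0_iff)
  have "(W p p' - L p p') - (W q p' - L q p') - (W p q' - L p q') + (W q q' - L q q') = 0"
  proof (rule bst_double [where W = "\<lambda>p p'. W p p' - L p p'", OF _ c])
    fix s s' assume s: "s \<in> modes \<beta> - {(0, 0, 0)}" and s': "s' \<in> modes \<beta> - {(0, 0, 0)}"
    have "(\<Sum>p\<in>cells \<beta>. \<Sum>p'\<in>cells \<beta>. cnj (amp (bst \<beta> s) p) * L p p' * amp (bst \<beta> s') p')
      = (\<Sum>p\<in>cells \<beta>. \<Sum>p'\<in>cells \<beta>. \<Sum>r\<in>modes \<beta>. l r * (cnj (amp (bst \<beta> s) p) * amp (bst \<beta> r) p)
           * (cnj (amp (bst \<beta> r) p') * amp (bst \<beta> s') p'))"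
      unfolding L_def sum_distrib_left sum_distrib_right by (intro sum.cong refl) (simp only: mult_ac)
    also have "\<dots> = (\<Sum>r\<in>modes \<beta>. \<Sum>p\<in>cells \<beta>. \<Sum>p'\<in>cells \<beta>. l r * (cnj (amp (bst \<beta> s) p) * amp (bst \<beta> r) p)
           * (cnj (amp (bst \<beta> r) p') * amp (bst \<beta> s') p'))"
      by (subst sum.swap [of _ "modes \<beta>" "cells \<beta>"]) (intro sum.cong refl sum.swap)
    also have "\<dots> = (\<Sum>r\<in>modes \<beta>. l r * (\<Sum>p\<in>cells \<beta>. cnj (amp (bst \<beta> s) p) * amp (bst \<beta> r) p)
           * (\<Sum>p'\<in>cells \<beta>. cnj (amp (bst \<beta> r) p') * amp (bst \<beta> s') p'))"
      by (simp only: scaled_sum_product)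
    also have "\<dots> = (\<Sum>r\<in>modes \<beta>. if r = s then (if s = s' then l s * ?V\<^sup>2 else 0) else 0)"
      using s s' by (intro sum.cong refl) (auto simp: bst_orth power2_eq_square)
    also have "\<dots> = (if s = s' then l s * ?V\<^sup>2 else 0)" using s by (simp add: )
    finally have L: "(\<Sum>p\<in>cells \<beta>. \<Sum>p'\<in>cells \<beta>. cnj (amp (bst \<beta> s) p) * L p p' * amp (bst \<beta> s') p')
      = (if s = s' then l s * ?V\<^sup>2 else 0)" .
    have W: "(\<Sum>p\<in>cells \<beta>. \<Sum>p'\<in>cells \<beta>. cnj (amp (bst \<beta> s) p) * W p p' * amp (bst \<beta> s') p')
      = (if s = s' then l s * ?V\<^sup>2 else 0)"
      using ker [OF s s'] V by (auto simp: l_def)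
    show "(\<Sum>p\<in>cells \<beta>. \<Sum>p'\<in>cells \<beta>. cnj (amp (bst \<beta> s) p) * (W p p' - L p p') * amp (bst \<beta> s') p') = 0"
      by (simp only: right_diff_distrib left_diff_distrib sum_subtractf W L) simp
  qed
  then show "let L = \<lambda>p p'. \<Sum>s\<in>modes \<beta>. l s * (amp (bst \<beta> s) p * cnj (amp (bst \<beta> s) p')) in
     W p p' - W q p' - W p q' + W q q' = L p p' - L q p' - L p q' + L q q'"
    unfolding Let_def L_def by (simp add: algebra_simps)
qed

section \<open>The pinwheel decomposition\<close>

datatype face = A1 | A2 | A3 | B1 | B2 | B3

lemma UNIV_face: "UNIV = {A1, A2, A3, B1, B2, B3}"
  using face.exhaust by auto

instance face :: finite
  by standard (simp add: UNIV_face)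

text \<open>Each party gets a pair of start and length. The point reflection of a shell exchanges Ai
  and Bi; the cyclic shift of the parties has the two orbits A1, B2, B3 and A2, A3, B1.\<close>

fun face_box :: "nat \<Rightarrow> nat \<Rightarrow> nat \<Rightarrow> nat \<Rightarrow> face \<Rightarrow> box" where
  "face_box dA dB dC t A1 = ((t + 1, dA - 2 * t - 1), (t, 1), (t, dC - 2 * t - 1))"
| "face_box dA dB dC t A2 = ((t + 1, dA - 2 * t - 1), (t, dB - 2 * t - 1), (dC - 1 - t, 1))"
| "face_box dA dB dC t A3 = ((dA - 1 - t, 1), (t + 1, dB - 2 * t - 1), (t, dC - 2 * t - 1))"
| "face_box dA dB dC t B1 = ((t, dA - 2 * t - 1), (dB - 1 - t, 1), (t + 1, dC - 2 * t - 1))"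
| "face_box dA dB dC t B2 = ((t, dA - 2 * t - 1), (t + 1, dB - 2 * t - 1), (t, 1))"
| "face_box dA dB dC t B3 = ((t, 1), (t, dB - 2 * t - 1), (t + 1, dC - 2 * t - 1))"

fun block :: "nat \<Rightarrow> nat \<Rightarrow> nat \<Rightarrow> nat \<Rightarrow> (nat \<times> face) option \<Rightarrow> box" where
  "block dA dB dC n (Some (t, f)) = face_box dA dB dC t f"
| "block dA dB dC n None =
    ((n + 1, dA - 2 * n - 2), (n + 1, dB - 2 * n - 2), (n + 1, dC - 2 * n - 2))"

lemma block_Some: "block dA dB dC n (Some x) = face_box dA dB dC (fst x) (snd x)"
  by (cases x) simp

definition labels :: "nat \<Rightarrow> (nat \<times> face) option set" where
  "labels n = insert None (Some ` ({..n} \<times> UNIV))"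

definition full :: "nat \<Rightarrow> nat \<Rightarrow> nat \<Rightarrow> cell set" where
  "full dA dB dC = {..<dA} \<times> {..<dB} \<times> {..<dC}"

lemma finite_full [simp]: "finite (full dA dB dC)"
  by (simp add: full_def)

lemma finite_labels [simp]: "finite (labels n)"
  by (simp add: labels_def)

lemma labels_cases:
  assumes "l \<in> labels n"
  obtains "l = None" | t f where "l = Some (t, f)" "t \<le> n"
  using assms by (auto simp: labels_def)

lemma bstates_collect:
  "bstates ((a, la), (b, lb), (c, lc)) = {tensor3 (fvec a la i) (fvec b lb j) (fvec c lc k) | i j k.
     i < la \<and> j < lb \<and> k < lc \<and> (i, j, k) \<noteq> (0, 0, 0)}"
  unfolding bstates_def by force

lemma setU_blocks:
  assumes "2 * n + 3 \<le> dA" "2 * n + 3 \<le> dB" "2 * n + 3 \<le> dC"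
  shows "setU dA dB dC n = (\<Union>l\<in>labels n. bstates (block dA dB dC n l)) \<union> {stopper dA dB dC}"
proof -
  have *: "setA1 dA dB dC t = bstates (face_box dA dB dC t A1)"
    "setA2 dA dB dC t = bstates (face_box dA dB dC t A2)"
    "setA3 dA dB dC t = bstates (face_box dA dB dC t A3)"
    "setB1 dA dB dC t = bstates (face_box dA dB dC t B1)"
    "setB2 dA dB dC t = bstates (face_box dA dB dC t B2)"
    "setB3 dA dB dC t = bstates (face_box dA dB dC t B3)" if "t \<le> n" for t
  proof -
    have e: "eta d t s = fvec t (d - 2 * t - 1) s" "xi d t s = fvec (t + 1) (d - 2 * t - 1) s"
      if "2 * n + 3 \<le> d" for d s
      by (rule eta_fvec xi_fvec; use that \<open>t \<le> n\<close> in linarith)+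
    note e = e [OF assms(1)] e [OF assms(2)] e [OF assms(3)]
    have [simp]: "\<And>j. j < 1 \<longleftrightarrow> j = (0::nat)" by auto
    show "setA1 dA dB dC t = bstates (face_box dA dB dC t A1)"
      "setA2 dA dB dC t = bstates (face_box dA dB dC t A2)"
      "setA3 dA dB dC t = bstates (face_box dA dB dC t A3)"
      "setB1 dA dB dC t = bstates (face_box dA dB dC t B1)"
      "setB2 dA dB dC t = bstates (face_box dA dB dC t B2)"
      "setB3 dA dB dC t = bstates (face_box dA dB dC t B3)"
      unfolding setA1_def setA2_def setA3_def setB1_def setB2_def setB3_def face_box.simps
        bstates_collect e ket_fvec
      by (rule Collect_cong, simp)+
  qed
  have F: "setF dA dB dC n = bstates (block dA dB dC n None)"
    unfolding setF_def block.simps bstates_collect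
    using assms by (simp add: beta_fvec)
  have "(\<Union>l\<in>labels n. bstates (block dA dB dC n l)) =
    bstates (block dA dB dC n None) \<union> (\<Union>t\<in>{0..n}. \<Union>f. bstates (face_box dA dB dC t f))"
    by (auto simp: labels_def)
  moreover have "(\<Union>t\<in>{0..n}. \<Union>f. bstates (face_box dA dB dC t f)) =
    (\<Union>t\<in>{0..n}. setA1 dA dB dC t \<union> setA2 dA dB dC t \<union> setA3 dA dB dC t \<union>
                  setB1 dA dB dC t \<union> setB2 dA dB dC t \<union> setB3 dA dB dC t)"
    by (rule SUP_cong) (simp_all only: * atLeastAtMost_iff UNIV_face UN_insert UN_empty Un_empty_right Un_assoc)
  ultimately show ?thesis by (simp only: setU_def F Un_ac)
qed

lemma stopper_bst: "stopper dA dB dC = bst ((0, dA), (0, dB), (0, dC)) (0, 0, 0)"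
  by (simp add: stopper_def ones_fvec)

lemma cells_full: "cells ((0, dA), (0, dB), (0, dC)) = full dA dB dC"
  by (auto simp: full_def)

lemma amp_stopper: "p \<in> full dA dB dC \<Longrightarrow> amp (stopper dA dB dC) p = 1"
  unfolding stopper_bst by (rule amp_bst_zero_mode) (simp only: cells_full)

lemma face_cells:
  assumes "2 * t + 3 \<le> dA" "2 * t + 3 \<le> dB" "2 * t + 3 \<le> dC"
  shows "(x, y, z) \<in> cells (face_box dA dB dC t A1) \<longleftrightarrow>
      t < x \<and> x + t < dA \<and> y = t \<and> t \<le> z \<and> z + t + 1 < dC"
    and "(x, y, z) \<in> cells (face_box dA dB dC t A2) \<longleftrightarrow>
      t < x \<and> x + t < dA \<and> t \<le> y \<and> y + t + 1 < dB \<and> z + t + 1 = dC"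
    and "(x, y, z) \<in> cells (face_box dA dB dC t A3) \<longleftrightarrow>
      x + t + 1 = dA \<and> t < y \<and> y + t < dB \<and> t \<le> z \<and> z + t + 1 < dC"
    and "(x, y, z) \<in> cells (face_box dA dB dC t B1) \<longleftrightarrow>
      t \<le> x \<and> x + t + 1 < dA \<and> y + t + 1 = dB \<and> t < z \<and> z + t < dC"
    and "(x, y, z) \<in> cells (face_box dA dB dC t B2) \<longleftrightarrow>
      t \<le> x \<and> x + t + 1 < dA \<and> t < y \<and> y + t < dB \<and> z = t"
    and "(x, y, z) \<in> cells (face_box dA dB dC t B3) \<longleftrightarrow>
      x = t \<and> t \<le> y \<and> y + t + 1 < dB \<and> t < z \<and> z + t < dC"
proof -
  have lo: "x \<in> {t..<t + (d - 2 * t - 1)} \<longleftrightarrow> t \<le> x \<and> x + t + 1 < d"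
    and hi: "x \<in> {t + 1..<t + 1 + (d - 2 * t - 1)} \<longleftrightarrow> t < x \<and> x + t < d"
    and top: "x \<in> {d - 1 - t..<d - 1 - t + 1} \<longleftrightarrow> x + t + 1 = d"
    and bot: "x \<in> {t..<t + 1} \<longleftrightarrow> x = t"
    if "2 * t + 3 \<le> d" for x d
    using that by auto
  note r = lo hi top bot
  show "(x, y, z) \<in> cells (face_box dA dB dC t A1) \<longleftrightarrow>
      t < x \<and> x + t < dA \<and> y = t \<and> t \<le> z \<and> z + t + 1 < dC"
    "(x, y, z) \<in> cells (face_box dA dB dC t A2) \<longleftrightarrow>
      t < x \<and> x + t < dA \<and> t \<le> y \<and> y + t + 1 < dB \<and> z + t + 1 = dC"
    "(x, y, z) \<in> cells (face_box dA dB dC t A3) \<longleftrightarrow>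
      x + t + 1 = dA \<and> t < y \<and> y + t < dB \<and> t \<le> z \<and> z + t + 1 < dC"
    "(x, y, z) \<in> cells (face_box dA dB dC t B1) \<longleftrightarrow>
      t \<le> x \<and> x + t + 1 < dA \<and> y + t + 1 = dB \<and> t < z \<and> z + t < dC"
    "(x, y, z) \<in> cells (face_box dA dB dC t B2) \<longleftrightarrow>
      t \<le> x \<and> x + t + 1 < dA \<and> t < y \<and> y + t < dB \<and> z = t"
    "(x, y, z) \<in> cells (face_box dA dB dC t B3) \<longleftrightarrow>
      x = t \<and> t \<le> y \<and> y + t + 1 < dB \<and> t < z \<and> z + t < dC"
    unfolding face_box.simps cells.simps mem_Times_iff fst_conv snd_conv
    by (simp_all only: r [OF assms(1)] r [OF assms(2)] r [OF assms(3)] bot [OF assms(1)] conj_assoc)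
qed

lemma core_cells:
  assumes "2 * n + 3 \<le> dA" "2 * n + 3 \<le> dB" "2 * n + 3 \<le> dC"
  shows "(x, y, z) \<in> cells (block dA dB dC n None) \<longleftrightarrow>
    n < x \<and> x + n + 1 < dA \<and> n < y \<and> y + n + 1 < dB \<and> n < z \<and> z + n + 1 < dC"
proof -
  have *: "x \<in> {n + 1..<n + 1 + (d - 2 * n - 2)} \<longleftrightarrow> n < x \<and> x + n + 1 < d"
    if "2 * n + 3 \<le> d" for x d
    using that by auto
  show ?thesis
    unfolding block.simps cells.simps mem_Times_iff fst_conv snd_conv
    by (simp only: * [OF assms(1)] * [OF assms(2)] * [OF assms(3)] conj_assoc)
qed

text \<open>A slab of shell t touches a side of the t-th nested box, while deeper shells and the
  core stay strictly inside. This separates the shells by linear arithmetic.\<close>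

lemma face_box_layer:
  assumes "2 * t + 3 \<le> dA" "2 * t + 3 \<le> dB" "2 * t + 3 \<le> dC"
    and "(x, y, z) \<in> cells (face_box dA dB dC t f)"
  shows "t \<le> x \<and> x + t < dA \<and> t \<le> y \<and> y + t < dB \<and> t \<le> z \<and> z + t < dC"
    and "x = t \<or> y = t \<or> z = t \<or> x + t + 1 = dA \<or> y + t + 1 = dB \<or> z + t + 1 = dC"
proof -
  note c = face_cells [OF assms(1-3)]
  show "t \<le> x \<and> x + t < dA \<and> t \<le> y \<and> y + t < dB \<and> t \<le> z \<and> z + t < dC"
    using assms by (cases f) (auto simp: c simp del: face_box.simps)
  show "x = t \<or> y = t \<or> z = t \<or> x + t + 1 = dA \<or> y + t + 1 = dB \<or> z + t + 1 = dC"
    using assms(4) by (cases f) (auto simp: c simp del: face_box.simps)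
qed

lemma cells_block_subset:
  assumes "l \<in> labels n" "2 * n + 3 \<le> dA" "2 * n + 3 \<le> dB" "2 * n + 3 \<le> dC"
  shows "cells (block dA dB dC n l) \<subseteq> full dA dB dC"
proof (rule subsetI)
  fix p assume p: "p \<in> cells (block dA dB dC n l)"
  obtain x y z where xyz: "p = (x, y, z)" by (cases p)
  show "p \<in> full dA dB dC" using assms(1)
  proof (cases rule: labels_cases)
    case 1
    then show ?thesis using p core_cells [OF assms(2-4), of x y z] by (simp add: xyz full_def)
  next
    case (2 t f)
    then show ?thesis using p face_box_layer(1) [of t dA dB dC x y z f] assms(2-4)
      by (simp add: xyz full_def)
  qed
qed

lemma face_box_disjoint:
  assumes "2 * t + 3 \<le> dA" "2 * t + 3 \<le> dB" "2 * t + 3 \<le> dC" "f \<noteq> f'"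
  shows "cells (face_box dA dB dC t f) \<inter> cells (face_box dA dB dC t f') = {}"
proof (rule Int_emptyI)
  fix p assume p: "p \<in> cells (face_box dA dB dC t f)" "p \<in> cells (face_box dA dB dC t f')"
  obtain x y z where xyz: "p = (x, y, z)" by (cases p)
  note c = face_cells [OF assms(1-3)]
  show False using p assms unfolding xyz
    by (cases f; cases f') (auto simp: c simp del: face_box.simps)
qed

lemma face_layer_disjoint:
  assumes "t < u" "2 * u + 3 \<le> dA" "2 * u + 3 \<le> dB" "2 * u + 3 \<le> dC"
  shows "cells (face_box dA dB dC t f) \<inter> cells (face_box dA dB dC u g) = {}"
proof (rule Int_emptyI)
  fix p assume p: "p \<in> cells (face_box dA dB dC t f)" "p \<in> cells (face_box dA dB dC u g)"
  obtain x y z where xyz: "p = (x, y, z)" by (cases p)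
  show False
    using face_box_layer(2) [of t dA dB dC x y z f] face_box_layer(1) [of u dA dB dC x y z g] p assms
    unfolding xyz by linarith
qed

lemma block_disjoint:
  assumes l: "l \<in> labels n" "l' \<in> labels n" "l \<noteq> l'"
    and d: "2 * n + 3 \<le> dA" "2 * n + 3 \<le> dB" "2 * n + 3 \<le> dC"
  shows "cells (block dA dB dC n l) \<inter> cells (block dA dB dC n l') = {}"
proof -
  have N: "cells (block dA dB dC n None) \<inter> cells (face_box dA dB dC t f) = {}" if "t \<le> n" for t f
  proof (rule Int_emptyI)
    fix p assume p: "p \<in> cells (block dA dB dC n None)" "p \<in> cells (face_box dA dB dC t f)"
    obtain x y z where xyz: "p = (x, y, z)" by (cases p)
    show False
      using face_box_layer(2) [of t dA dB dC x y z f] p d that core_cells [OF d, of x y z]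
      unfolding xyz by linarith
  qed
  have F: "cells (face_box dA dB dC t f) \<inter> cells (face_box dA dB dC u g) = {}"
    if "t \<le> n" "u \<le> n" "(t, f) \<noteq> (u, g)" for t u f g
  proof (cases t u rule: linorder_cases)
    case less
    then show ?thesis using face_layer_disjoint [of t u] that d by simp
  next
    case equal
    then show ?thesis using face_box_disjoint [of t] that d by simp
  next
    case greater
    then show ?thesis using face_layer_disjoint [of u t] that d by (simp add: Int_commute)
  qed
  show ?thesis using l
    by (elim labels_cases) (auto simp: N F Int_commute simp del: block.simps(2) face_box.simps)
qed

section \<open>Inner products of box states and orthogonality of the set\<close>

lemma inner3_amp: "inner3 dA dB dC u v = (\<Sum>p\<in>full dA dB dC. cnj (amp u p) * amp v p)"
  by (simp add: inner3_def full_def amp_def sum.cartesian_product case_prod_beta)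

lemma inner3_bst:
  assumes "cells \<beta> \<subseteq> full dA dB dC"
  shows "inner3 dA dB dC (bst \<beta> s) v = (\<Sum>p\<in>cells \<beta>. cnj (amp (bst \<beta> s) p) * amp v p)"
  unfolding inner3_amp using assms by (intro sum.mono_neutral_right) (auto simp: amp_bst_0)

lemma inner3_commute: "inner3 dA dB dC u v = cnj (inner3 dA dB dC v u)"
  by (simp add: inner3_def mult.commute)

lemma zero_mode: "s \<in> modes \<beta> \<Longrightarrow> (0, 0, 0) \<in> modes \<beta>"
  by (cases \<beta> rule: cells.cases) auto

lemma modes_cells: "s \<in> modes \<beta> \<Longrightarrow> cells \<beta> \<noteq> {}"
  by (cases \<beta> rule: cells.cases) auto

text \<open>On a box the stopper coincides with the constant mode.\<close>

lemma inner3_bst_stopper: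
  assumes "cells \<beta> \<subseteq> full dA dB dC" "s \<in> modes \<beta>" "s \<noteq> (0, 0, 0)"
  shows "inner3 dA dB dC (bst \<beta> s) (stopper dA dB dC) = 0"
proof -
  have "inner3 dA dB dC (bst \<beta> s) (stopper dA dB dC)
    = (\<Sum>p\<in>cells \<beta>. cnj (amp (bst \<beta> s) p) * amp (bst \<beta> (0, 0, 0)) p)"
    unfolding inner3_bst [OF assms(1)] using assms(1)
    by (intro sum.cong refl) (auto simp: amp_stopper amp_bst_zero_mode)
  then show ?thesis using bst_orth [OF assms(2) zero_mode [OF assms(2)]] assms(3) by simp
qed

lemma inner3_bst_disjoint:
  assumes "cells \<beta> \<subseteq> full dA dB dC" "cells \<beta> \<inter> cells \<beta>' = {}"
  shows "inner3 dA dB dC (bst \<beta> s) (bst \<beta>' s') = 0"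
  unfolding inner3_bst [OF assms(1)]
proof (intro sum.neutral ballI)
  fix p assume "p \<in> cells \<beta>"
  then have "amp (bst \<beta>' s') p = 0" using assms(2) by (intro amp_bst_0) blast
  then show "cnj (amp (bst \<beta> s) p) * amp (bst \<beta>' s') p = 0" by simp
qed

lemma inner3_bst_self:
  assumes "cells \<beta> \<subseteq> full dA dB dC" "s \<in> modes \<beta>"
  shows "inner3 dA dB dC (bst \<beta> s) (bst \<beta> s) \<noteq> 0"
  using assms modes_cells [OF assms(2)]
  by (simp add: inner3_bst bst_orth card_eq_0_iff)

lemma inner3_stopper_self:
  assumes "0 < dA" "0 < dB" "0 < dC"
  shows "inner3 dA dB dC (stopper dA dB dC) (stopper dA dB dC) \<noteq> 0"
  unfolding stopper_bst
  by (rule inner3_bst_self) (use assms in \<open>auto simp: full_def\<close>)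

lemma setU_cases:
  assumes "\<psi> \<in> setU dA dB dC n" "2 * n + 3 \<le> dA" "2 * n + 3 \<le> dB" "2 * n + 3 \<le> dC"
  obtains (stopper) "\<psi> = stopper dA dB dC"
  | (block) l s where "l \<in> labels n" "s \<in> modes (block dA dB dC n l)" "s \<noteq> (0, 0, 0)"
      "\<psi> = bst (block dA dB dC n l) s"
  using assms by (auto simp: setU_blocks bstates_def)

lemma setU_orthogonal:
  assumes d: "2 * n + 3 \<le> dA" "2 * n + 3 \<le> dB" "2 * n + 3 \<le> dC"
  shows "mutually_orthogonal3 dA dB dC (setU dA dB dC n)"
  unfolding mutually_orthogonal3_def
proof (intro ballI impI)
  fix \<psi> \<phi> assume S: "\<psi> \<in> setU dA dB dC n" "\<phi> \<in> setU dA dB dC n" and ne: "\<psi> \<noteq> \<phi>"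
  note sub = cells_block_subset [OF _ d]
  show "inner3 dA dB dC \<psi> \<phi> = 0"
    using S(1) d
  proof (cases rule: setU_cases)
    case stopper
    show ?thesis using S(2) d
    proof (cases rule: setU_cases)
      case stopper
      then show ?thesis using ne \<open>\<psi> = _\<close> by simp
    next
      case (block l s)
      then show ?thesis using inner3_bst_stopper [OF sub] \<open>\<psi> = _\<close> by (subst inner3_commute) simp
    qed
  next
    case (block l s)
    note b = this
    show ?thesis using S(2) d
    proof (cases rule: setU_cases)
      case stopper
      then show ?thesis using inner3_bst_stopper [OF sub] b by simp
    next
      case (block l' s')
      show ?thesis
      proof (cases "l = l'")
        case True
        then have "s \<noteq> s'" using b block ne by auto
        then show ?thesis using True b block sub by (simp add: inner3_bst bst_orth)
      next
        case False
        then show ?thesis using b block sub block_disjoint [OF _ _ False d]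
          by (simp add: inner3_bst_disjoint)
      qed
    qed
  qed
qed

lemma setU_inner_self:
  assumes d: "2 * n + 3 \<le> dA" "2 * n + 3 \<le> dB" "2 * n + 3 \<le> dC"
    and "\<psi> \<in> setU dA dB dC n"
  shows "inner3 dA dB dC \<psi> \<psi> \<noteq> 0"
  using assms(4) d
proof (cases rule: setU_cases)
  case stopper
  then show ?thesis using inner3_stopper_self [of dA dB dC] d by simp
next
  case (block l s)
  then show ?thesis using inner3_bst_self cells_block_subset [OF _ d] by simp
qed

lemma bst_product:
  assumes "cells \<beta> \<subseteq> full dA dB dC" "s \<in> modes \<beta>"
  shows "is_product3 dA dB dC (bst \<beta> s)"
proof -
  obtain a la b lb c lc where \<beta>: "\<beta> = ((a, la), (b, lb), (c, lc))"
    by (cases \<beta> rule: cells.cases)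
  obtain i j k where s: "s = (i, j, k)" by (cases s)
  have pos: "0 < la" "0 < lb" "0 < lc" using assms(2) by (auto simp: \<beta> s)
  have "(a + la - 1, b + lb - 1, c + lc - 1) \<in> cells \<beta>" using pos by (auto simp: \<beta>)
  then have "(a + la - 1, b + lb - 1, c + lc - 1) \<in> full dA dB dC" using assms(1) by blast
  then have "a + la \<le> dA" "b + lb \<le> dB" "c + lc \<le> dC" using pos by (auto simp: full_def)
  then have "\<forall>x\<ge>dA. fvec a la i x = 0" "\<forall>x\<ge>dB. fvec b lb j x = 0" "\<forall>x\<ge>dC. fvec c lc k x = 0"
    by (auto simp: fvec_def)
  then show ?thesis unfolding is_product3_def \<beta> s bst.simps by blast
qed

lemma setU_product:
  assumes "\<psi> \<in> setU dA dB dC n" and d: "2 * n + 3 \<le> dA" "2 * n + 3 \<le> dB" "2 * n + 3 \<le> dC"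
  shows "is_product3 dA dB dC \<psi>"
  using assms
proof (cases rule: setU_cases)
  case stopper
  then show ?thesis unfolding stopper_bst
    using bst_product [of "((0, dA), (0, dB), (0, dC))" dA dB dC "(0, 0, 0)"] d
    by (simp only: cells_full) simp
next
  case (block l s)
  then show ?thesis using bst_product cells_block_subset [OF _ d] by simp
qed

section \<open>Volumes and cardinality\<close>

lemma face_volume:
  assumes "2 * t + 2 \<le> dA" "2 * t + 2 \<le> dB" "2 * t + 2 \<le> dC"
  shows "(\<Sum>f\<in>UNIV. card (cells (face_box dA dB dC t f))) + 2
      + (dA - 2 * Suc t) * (dB - 2 * Suc t) * (dC - 2 * Suc t)
    = (dA - 2 * t) * (dB - 2 * t) * (dC - 2 * t)"
proof -
  \<comment> \<open>Substituting the excess over 2t + 2 removes all truncated subtractions and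
    leaves a polynomial identity.\<close>
  obtain x y z where "dA = 2 * t + 2 + x" "dB = 2 * t + 2 + y" "dC = 2 * t + 2 + z"
    using assms by (metis le_add_diff_inverse)
  then show ?thesis by (simp add: UNIV_face card_cartesian_product algebra_simps)
qed

text \<open>\<open>face_volume\<close> telescopes over the shells: each contributes six slabs and
  two untiled corners, and what is left after the last one is the core.\<close>

lemma block_volume:
  assumes "2 * n + 3 \<le> dA" "2 * n + 3 \<le> dB" "2 * n + 3 \<le> dC"
  shows "(\<Sum>l\<in>labels n. card (cells (block dA dB dC n l))) + 2 * (n + 1) = dA * dB * dC"
proof -
  have *: "(\<Sum>t\<le>m. \<Sum>f\<in>UNIV. card (cells (face_box dA dB dC t f))) + 2 * (m + 1)
    + (dA - 2 * Suc m) * (dB - 2 * Suc m) * (dC - 2 * Suc m) = dA * dB * dC" if "m \<le> n" for m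
    using that
  proof (induction m)
    case 0
    then show ?case using face_volume [of 0 dA dB dC] assms by simp
  next
    case (Suc m)
    then show ?case using face_volume [of "Suc m" dA dB dC] assms by simp
  qed
  have "(\<Sum>l\<in>labels n. card (cells (block dA dB dC n l)))
    = card (cells (block dA dB dC n None)) + (\<Sum>t\<le>n. \<Sum>f\<in>UNIV. card (cells (face_box dA dB dC t f)))"
    unfolding labels_def
    by (simp add: sum.reindex sum.cartesian_product case_prod_beta' comp_def block_Some del: block.simps(2))
  moreover have "card (cells (block dA dB dC n None))
    = (dA - 2 * Suc n) * (dB - 2 * Suc n) * (dC - 2 * Suc n)"
    by (simp add: card_cartesian_product mult.assoc)
  ultimately show ?thesis using * [of n] by linarith
qed

text \<open>A box state is nonzero exactly on its cells, so it determines its box among disjoint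
  ones; inside a box, orthogonality separates the modes. The states form a set of vectors, so
  counting them and using orthogonality of distinct members both require this.\<close>

lemma bst_inj:
  assumes "bst \<beta> s = bst \<beta>' s'" "s \<in> modes \<beta>" "s' \<in> modes \<beta>'"
    "\<beta> = \<beta>' \<or> cells \<beta> \<inter> cells \<beta>' = {}"
  shows "\<beta> = \<beta>' \<and> s = s'"
proof -
  obtain p where p: "p \<in> cells \<beta>" using modes_cells [OF assms(2)] by auto
  have "p \<in> cells \<beta>'" using amp_bst_nz [OF p, of s] assms(1) amp_bst_0 by metis
  then have "\<beta> = \<beta>'" using assms(4) p by auto
  moreover have "s = s'"
    using bst_orth [of s \<beta> s'] bst_orth [of s \<beta> s] assms p \<open>\<beta> = \<beta>'\<close>
    by (auto simp: card_eq_0_iff split: if_splits)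
  ultimately show ?thesis by simp
qed

lemma block_nonempty:
  assumes "l \<in> labels n" "2 * n + 3 \<le> dA" "2 * n + 3 \<le> dB" "2 * n + 3 \<le> dC"
  shows "(0, 0, 0) \<in> modes (block dA dB dC n l)"
  using assms(1)
proof (cases rule: labels_cases)
  case 1
  then show ?thesis using assms by auto
next
  case (2 t f)
  then show ?thesis using assms by (cases f) auto
qed

text \<open>There are 6 (n + 1) + 1 boxes that lose one mode each, 2 (n + 1) corners outside all
  boxes, and one stopper: 6 (n + 1) + 1 + 2 (n + 1) - 1 = 8 (n + 1).\<close>

lemma card_setU:
  assumes d: "2 * n + 3 \<le> dA" "2 * n + 3 \<le> dB" "2 * n + 3 \<le> dC"
  shows "card (setU dA dB dC n) = dA * dB * dC - 8 * (n + 1)"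
proof -
  let ?b = "block dA dB dC n"
  have card_b: "card (bstates (?b l)) + 1 = card (cells (?b l))" if "l \<in> labels n" for l
  proof -
    have "inj_on (bst (?b l)) (modes (?b l) - {(0, 0, 0)})"
    proof (rule inj_onI)
      fix s s' assume "s \<in> modes (?b l) - {(0, 0, 0)}" "s' \<in> modes (?b l) - {(0, 0, 0)}"
        "bst (?b l) s = bst (?b l) s'"
      then show "s = s'" using bst_inj [of "?b l" s "?b l" s'] by simp
    qed
    then have "card (bstates (?b l)) = card (modes (?b l)) - 1"
      unfolding bstates_def using block_nonempty [OF that d] by (simp add: card_image)
    moreover have "card (modes (?b l)) > 0"
      using block_nonempty [OF that d] by (auto simp: card_gt_0_iff)
    ultimately show ?thesis by (simp add: card_modes)
  qed
  have disj: "bstates (?b l) \<inter> bstates (?b l') = {}"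
    if "l \<in> labels n" "l' \<in> labels n" "l \<noteq> l'" for l l'
  proof (rule Int_emptyI)
    fix \<psi> assume \<psi>: "\<psi> \<in> bstates (?b l)" "\<psi> \<in> bstates (?b l')"
    from \<psi>(1) obtain s where s1: "\<psi> = bst (?b l) s" "s \<in> modes (?b l)"
      unfolding bstates_def by blast
    from \<psi>(2) obtain s' where s2: "\<psi> = bst (?b l') s'" "s' \<in> modes (?b l')"
      unfolding bstates_def by blast
    have s: "bst (?b l) s = bst (?b l') s'" "s \<in> modes (?b l)" "s' \<in> modes (?b l')"
      using s1 s2 by simp_all
    have c: "cells (?b l) \<inter> cells (?b l') = {}" by (rule block_disjoint [OF that d])
    then have "?b l = ?b l'" using bst_inj [OF s disjI2] by simp
    then show False using c modes_cells [OF s(2)] by simp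
  qed
  have "card (\<Union>l\<in>labels n. bstates (?b l)) = (\<Sum>l\<in>labels n. card (bstates (?b l)))"
  proof (rule card_UN_disjoint)
    show "\<forall>l\<in>labels n. finite (bstates (?b l))" by (simp add: bstates_def)
  qed (simp_all add: disj)
  moreover have "(\<Sum>l\<in>labels n. card (bstates (?b l))) + card (labels n)
    = (\<Sum>l\<in>labels n. card (cells (?b l)))"
  proof -
    have "(\<Sum>l\<in>labels n. card (cells (?b l))) = (\<Sum>l\<in>labels n. card (bstates (?b l)) + 1)"
      by (intro sum.cong refl card_b [symmetric])
    then show ?thesis by (simp only: sum.distrib card_eq_sum)
  qed
  moreover have "card (labels n) = 6 * (n + 1) + 1"
  proof -
    have "card (UNIV :: face set) = 6" by (simp add: UNIV_face)
    moreover have "card (Some ` ({..n} \<times> (UNIV :: face set))) = card ({..n} \<times> (UNIV :: face set))"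
      by (rule card_image) (rule inj_Some)
    ultimately show ?thesis by (simp add: labels_def card_cartesian_product)
  qed
  moreover have "stopper dA dB dC \<notin> (\<Union>l\<in>labels n. bstates (?b l))"
  proof
    assume "stopper dA dB dC \<in> (\<Union>l\<in>labels n. bstates (?b l))"
    then obtain l s where "l \<in> labels n" "s \<in> modes (?b l)" "s \<noteq> (0, 0, 0)"
      "stopper dA dB dC = bst (?b l) s" by (auto simp: bstates_def)
    then show False
      using inner3_bst_stopper [OF cells_block_subset [OF _ d], of l s]
        inner3_bst_self [OF cells_block_subset [OF _ d], of l s] by simp
  qed
  moreover have "finite (\<Union>l\<in>labels n. bstates (?b l))" by (simp add: bstates_def)
  ultimately show ?thesis
    unfolding setU_blocks [OF d] using block_volume [OF d]
    by (simp only: Un_insert_right Un_empty_right card_insert_disjoint simp_thms)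
qed

lemma corner_notin_block:
  assumes "l \<in> labels n" "2 * n + 3 \<le> dA" "2 * n + 3 \<le> dB" "2 * n + 3 \<le> dC"
  shows "(0, 0, 0) \<notin> cells (block dA dB dC n l)"
    and "(dA - 1, dB - 1, dC - 1) \<notin> cells (block dA dB dC n l)"
proof -
  have "(0, 0, 0) \<notin> cells (block dA dB dC n l) \<and> (dA - 1, dB - 1, dC - 1) \<notin> cells (block dA dB dC n l)"
    using assms(1)
  proof (cases rule: labels_cases)
    case 1
    then show ?thesis by (auto simp: core_cells [OF assms(2-4)] simp del: block.simps)
  next
    case (2 t f)
    then have t: "2 * t + 3 \<le> dA" "2 * t + 3 \<le> dB" "2 * t + 3 \<le> dC" using assms by auto
    show ?thesis unfolding 2 block.simps using t
      by (cases f) (auto simp: face_cells [OF t] simp del: face_box.simps)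
  qed
  then show "(0, 0, 0) \<notin> cells (block dA dB dC n l)"
    and "(dA - 1, dB - 1, dC - 1) \<notin> cells (block dA dB dC n l)" by auto
qed

text \<open>The difference of the two outermost corners is orthogonal to every state of the set.\<close>

lemma setU_not_spanning:
  assumes d: "2 * n + 3 \<le> dA" "2 * n + 3 \<le> dB" "2 * n + 3 \<le> dC"
  shows "\<not> {v. in_space dA dB dC v} \<subseteq> cspan3 (setU dA dB dC n)"
proof
  define o1 where "o1 = (0::nat, 0::nat, 0::nat)"
  define o2 where "o2 = (dA - 1, dB - 1, dC - 1)"
  define w :: "nat \<Rightarrow> nat \<Rightarrow> nat \<Rightarrow> complex" where
    "w = (\<lambda>i j k. if (i, j, k) = o1 then 1 else if (i, j, k) = o2 then -1 else 0)"
  have o: "o1 \<in> full dA dB dC" "o2 \<in> full dA dB dC" "o1 \<noteq> o2"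
    using d by (auto simp: o1_def o2_def full_def)
  have inner: "inner3 dA dB dC w v = amp v o1 - amp v o2" for v
  proof -
    have "inner3 dA dB dC w v = (\<Sum>p\<in>full dA dB dC. (if p = o1 then amp v o1 else 0) - (if p = o2 then amp v o2 else 0))"
      unfolding inner3_amp using o by (intro sum.cong) (auto simp: w_def amp_def)
    then show ?thesis using o by (simp add: sum_subtractf)
  qed
  have orth: "inner3 dA dB dC w \<psi> = 0" if "\<psi> \<in> setU dA dB dC n" for \<psi>
    using that d
  proof (cases rule: setU_cases)
    case stopper
    then show ?thesis using o by (simp add: inner amp_stopper)
  next
    case (block l s)
    then show ?thesis using corner_notin_block [OF _ d]
      by (simp add: inner amp_bst_0 o1_def o2_def)
  qed
  assume "{v. in_space dA dB dC v} \<subseteq> cspan3 (setU dA dB dC n)"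
  moreover have "in_space dA dB dC w"
    using d by (auto simp: in_space_def w_def o1_def o2_def)
  ultimately obtain F c where F: "F \<subseteq> setU dA dB dC n"
    "w = (\<lambda>i j k. \<Sum>\<psi>\<in>F. c \<psi> * \<psi> i j k)"
    unfolding cspan3_def by blast
  have "amp w = (\<lambda>p. \<Sum>\<psi>\<in>F. c \<psi> * amp \<psi> p)"
    by (subst F(2)) (auto simp: amp_def)
  \<comment> \<open>A vector of the span that is orthogonal to the set has norm zero, whereas w has
    squared norm 2.\<close>
  then have "inner3 dA dB dC w w = (\<Sum>\<psi>\<in>F. c \<psi> * inner3 dA dB dC w \<psi>)"
    unfolding inner by (simp add: sum_subtractf right_diff_distrib)
  also have "\<dots> = 0" using orth F(1) by (intro sum.neutral) auto
  finally have "inner3 dA dB dC w w = 0" .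
  moreover have "amp w o1 = 1" by (simp add: amp_def w_def o1_def)
  moreover have "amp w o2 = -1"
    using o(3) by (cases o2) (simp add: amp_def w_def)
  ultimately show False by (simp add: inner)
qed

section \<open>Unextendibility\<close>

text \<open>A shell moved so that its untiled corners are (0, 0, 0) and (p, q, r). The conjuncts
  state constancy of the product on A1, A2, A3, B1, B2, B3, in this order. Without boxes and
  dimensions the condition is easy to rotate and reflect, and one slab stands for all six.\<close>

definition pinwheel :: "nat \<Rightarrow> nat \<Rightarrow> nat \<Rightarrow> (nat \<Rightarrow> complex) \<Rightarrow> (nat \<Rightarrow> complex) \<Rightarrow> (nat \<Rightarrow> complex) \<Rightarrow> bool" where
  "pinwheel p q r a b c \<longleftrightarrow>
    (\<forall>i i' k k'. 0 < i \<and> i \<le> p \<and> 0 < i' \<and> i' \<le> p \<and> k < r \<and> k' < r \<longrightarrow> a i * b 0 * c k = a i' * b 0 * c k') \<and>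
    (\<forall>i i' j j'. 0 < i \<and> i \<le> p \<and> 0 < i' \<and> i' \<le> p \<and> j < q \<and> j' < q \<longrightarrow> a i * b j * c r = a i' * b j' * c r) \<and>
    (\<forall>j j' k k'. 0 < j \<and> j \<le> q \<and> 0 < j' \<and> j' \<le> q \<and> k < r \<and> k' < r \<longrightarrow> a p * b j * c k = a p * b j' * c k') \<and>
    (\<forall>i i' k k'. i < p \<and> i' < p \<and> 0 < k \<and> k \<le> r \<and> 0 < k' \<and> k' \<le> r \<longrightarrow> a i * b q * c k = a i' * b q * c k') \<and>
    (\<forall>i i' j j'. i < p \<and> i' < p \<and> 0 < j \<and> j \<le> q \<and> 0 < j' \<and> j' \<le> q \<longrightarrow> a i * b j * c 0 = a i' * b j' * c 0) \<and>
    (\<forall>j j' k k'. j < q \<and> j' < q \<and> 0 < k \<and> k \<le> r \<and> 0 < k' \<and> k' \<le> r \<longrightarrow> a 0 * b j * c k = a 0 * b j' * c k')"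

lemma pinwheelD:
  assumes "pinwheel p q r a b c"
  shows "0 < i \<Longrightarrow> i \<le> p \<Longrightarrow> 0 < i' \<Longrightarrow> i' \<le> p \<Longrightarrow> k < r \<Longrightarrow> k' < r \<Longrightarrow> a i * b 0 * c k = a i' * b 0 * c k'"
    and "0 < i \<Longrightarrow> i \<le> p \<Longrightarrow> 0 < i' \<Longrightarrow> i' \<le> p \<Longrightarrow> j < q \<Longrightarrow> j' < q \<Longrightarrow> a i * b j * c r = a i' * b j' * c r"
    and "0 < j \<Longrightarrow> j \<le> q \<Longrightarrow> 0 < j' \<Longrightarrow> j' \<le> q \<Longrightarrow> k < r \<Longrightarrow> k' < r \<Longrightarrow> a p * b j * c k = a p * b j' * c k'"
    and "i < p \<Longrightarrow> i' < p \<Longrightarrow> 0 < k \<Longrightarrow> k \<le> r \<Longrightarrow> 0 < k' \<Longrightarrow> k' \<le> r \<Longrightarrow> a i * b q * c k = a i' * b q * c k'"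
    and "i < p \<Longrightarrow> i' < p \<Longrightarrow> 0 < j \<Longrightarrow> j \<le> q \<Longrightarrow> 0 < j' \<Longrightarrow> j' \<le> q \<Longrightarrow> a i * b j * c 0 = a i' * b j' * c 0"
    and "j < q \<Longrightarrow> j' < q \<Longrightarrow> 0 < k \<Longrightarrow> k \<le> r \<Longrightarrow> 0 < k' \<Longrightarrow> k' \<le> r \<Longrightarrow> a 0 * b j * c k = a 0 * b j' * c k'"
  using assms unfolding pinwheel_def by simp_all

lemma pinwheel_rotate:
  assumes "pinwheel p q r a b c"
  shows "pinwheel q r p b c a"
proof -
  note D = pinwheelD [OF assms]
  show ?thesis
    unfolding pinwheel_def
  proof (intro conjI allI impI; elim conjE)
    fix i i' k k' assume "0 < i" "i \<le> q" "0 < i'" "i' \<le> q" "k < p" "k' < p"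
    then show "b i * c 0 * a k = b i' * c 0 * a k'" using D(5) [of k k' i i'] by (simp add: mult_ac)
  next
    fix i i' j j' assume "0 < i" "i \<le> q" "0 < i'" "i' \<le> q" "j < r" "j' < r"
    then show "b i * c j * a p = b i' * c j' * a p" using D(3) [of i i' j j'] by (simp add: mult_ac)
  next
    fix j j' k k' assume "0 < j" "j \<le> r" "0 < j'" "j' \<le> r" "k < p" "k' < p"
    then show "b q * c j * a k = b q * c j' * a k'" using D(4) [of k k' j j'] by (simp add: mult_ac)
  next
    fix i i' k k' assume "i < q" "i' < q" "0 < k" "k \<le> p" "0 < k'" "k' \<le> p"
    then show "b i * c r * a k = b i' * c r * a k'" using D(2) [of k k' i i'] by (simp add: mult_ac)
  next
    fix i i' j j' assume "i < q" "i' < q" "0 < j" "j \<le> r" "0 < j'" "j' \<le> r"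
    then show "b i * c j * a 0 = b i' * c j' * a 0" using D(6) [of i i' j j'] by (simp add: mult_ac)
  next
    fix j j' k k' assume "j < r" "j' < r" "0 < k" "k \<le> p" "0 < k'" "k' \<le> p"
    then show "b 0 * c j * a k = b 0 * c j' * a k'" using D(1) [of k k' j j'] by (simp add: mult_ac)
  qed
qed

text \<open>The point reflection exchanges Ai and Bi, so what rotations give for A1, B2, B3 carries
  over to B1, A2, A3.\<close>

lemma pinwheel_reflect:
  assumes "pinwheel p q r a b c"
  shows "pinwheel p q r (\<lambda>i. a (p - i)) (\<lambda>j. b (q - j)) (\<lambda>k. c (r - k))"
proof -
  note D = pinwheelD [OF assms]
  show ?thesis
    unfolding pinwheel_def
    by (intro conjI allI impI; elim conjE; simp only: diff_zero diff_self_eq_0; rule D; arith)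
qed

text \<open>A nonzero value on A1 makes a constant on 1..p, c constant on 0..r-1 and, through A3, b
  constant on 1..q. Then either b is concentrated at 0 and a 0 = c r = 0, or all three factors are
  constant throughout. In both cases all three sums are nonzero.\<close>

lemma pinwheel_face_zero:
  assumes pw: "pinwheel p q r a b c" and ge: "2 \<le> p" "2 \<le> q" "2 \<le> r"
    and sum: "sum a {..p} * sum b {..q} * sum c {..r} = 0"
    and ik: "0 < i" "i \<le> p" "k < r"
  shows "a i * b 0 * c k = 0"
proof (rule ccontr)
  note D = pinwheelD [OF pw]
  assume "a i * b 0 * c k \<noteq> 0"
  then have "a p * b 0 * c 0 \<noteq> 0" using D(1) [of i p k 0] ik ge by simp
  then have nz: "a p \<noteq> 0" "b 0 \<noteq> 0" "c 0 \<noteq> 0" by auto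
  have a: "a i = a p" if "0 < i" "i \<le> p" for i using D(1) [of i p 0 0] that ge nz by simp
  have c: "c k = c 0" if "k < r" for k using D(1) [of p p k 0] that ge nz by simp
  have b: "b j = b q" if "0 < j" "j \<le> q" for j using D(3) [of j q 0 0] that ge nz by simp
  show False
  proof (cases "b q = 0")
    case True
    then have b0: "b j = 0" if "0 < j" "j \<le> q" for j using b [OF that] True by simp
    \<comment> \<open>The slabs A2 and B3 carry the zero b 1 over to (p, 0, r) and (0, 0, 1), where
      only c r and a 0 can be the vanishing factor.\<close>
    have "c r = 0" using D(2) [of p p 0 1] b0 [of 1] ge nz by simp
    have "a 0 = 0" using D(6) [of 0 1 1 1] b0 [of 1] c [of 1] ge nz by simp
    have "sum b {..q} = (\<Sum>j\<in>{..q}. if j = 0 then b 0 else 0)"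
      by (rule sum.cong) (auto simp: b0)
    then have sb: "sum b {..q} = b 0" by simp
    have "sum c {..r} = sum c {..<r}" using \<open>c r = 0\<close> by (simp add: lessThan_Suc_atMost [symmetric])
    also have "\<dots> = (\<Sum>k<r. c 0)" by (rule sum.cong [OF refl], rule c) auto
    finally have sc: "sum c {..r} = of_nat r * c 0" by simp
    have "sum a {..p} = sum a {0<..p}"
      by (rule sum.mono_neutral_right) (auto simp: \<open>a 0 = 0\<close>)
    also have "\<dots> = (\<Sum>i\<in>{0<..p}. a p)" by (rule sum.cong [OF refl], rule a) auto
    finally have sa: "sum a {..p} = of_nat p * a p" by simp
    show False using sum nz ge unfolding sa sb sc by simp
  next
    case False
    \<comment> \<open>The slabs B2, B1 and A2 in turn attach the end values a 0, c r and b
      0.\<close>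
    have "a 0 = a 1" using D(5) [of 0 1 q q] False nz ge by simp
    then have a': "a i = a p" if "i \<le> p" for i using a [of 1] a [of i] that ge by (cases i) auto
    have "c r = c 1" using D(4) [of 1 1 r 1] False nz ge a [of 1] by simp
    then have c': "c k = c 0" if "k \<le> r" for k using c [of 1] c [of k] that ge by (cases "k = r") auto
    have "b 0 = b 1" using D(2) [of p p 0 1] nz ge c' [of r] by simp
    then have b': "b j = b q" if "j \<le> q" for j using b [of 1] b [of j] that ge by (cases j) auto
    have "sum a {..p} = (\<Sum>i\<le>p. a p)" by (rule sum.cong [OF refl], rule a') simp
    moreover have "sum b {..q} = (\<Sum>i\<le>q. b q)" by (rule sum.cong [OF refl], rule b') simp
    moreover have "sum c {..r} = (\<Sum>i\<le>r. c 0)" by (rule sum.cong [OF refl], rule c') simp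
    ultimately show False using sum False nz by (simp del: of_nat_Suc)
  qed
qed

lemma sum_reflect: "sum (\<lambda>i. a (p - i)) {..p} = sum a {..(p::nat)}"
  by (rule sum.reindex_bij_witness [of _ "\<lambda>i. p - i" "\<lambda>i. p - i"]) auto

lemma pinwheel_faces_zero:
  assumes pw: "pinwheel p q r a b c" and ge: "2 \<le> p" "2 \<le> q" "2 \<le> r"
    and sum: "sum a {..p} * sum b {..q} * sum c {..r} = 0"
  shows "0 < i \<Longrightarrow> i \<le> p \<Longrightarrow> k < r \<Longrightarrow> a i * b 0 * c k = 0"
    and "i < p \<Longrightarrow> 0 < j \<Longrightarrow> j \<le> q \<Longrightarrow> a i * b j * c 0 = 0"
    and "j < q \<Longrightarrow> 0 < k \<Longrightarrow> k \<le> r \<Longrightarrow> a 0 * b j * c k = 0"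
proof -
  show "0 < i \<Longrightarrow> i \<le> p \<Longrightarrow> k < r \<Longrightarrow> a i * b 0 * c k = 0"
    by (rule pinwheel_face_zero [OF pw ge sum])
  have "0 < j \<Longrightarrow> j \<le> q \<Longrightarrow> i < p \<Longrightarrow> b j * c 0 * a i = 0"
    by (rule pinwheel_face_zero [OF pinwheel_rotate [OF pw] ge(2,3,1)]) (use sum in \<open>simp_all add: mult_ac\<close>)
  then show "i < p \<Longrightarrow> 0 < j \<Longrightarrow> j \<le> q \<Longrightarrow> a i * b j * c 0 = 0" by auto
  have "0 < k \<Longrightarrow> k \<le> r \<Longrightarrow> j < q \<Longrightarrow> c k * a 0 * b j = 0"
    by (rule pinwheel_face_zero [OF pinwheel_rotate [OF pinwheel_rotate [OF pw]] ge(3,1,2)])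
      (use sum in \<open>simp_all add: mult_ac\<close>)
  then show "j < q \<Longrightarrow> 0 < k \<Longrightarrow> k \<le> r \<Longrightarrow> a 0 * b j * c k = 0" by auto
qed

text \<open>The corner belongs to no slab. If the product is nonzero there, the vanishing slabs next
  to it force each factor to be concentrated at 0, and the total sum is the corner value.\<close>

lemma pinwheel_corner_zero:
  assumes pw: "pinwheel p q r a b c" and ge: "2 \<le> p" "2 \<le> q" "2 \<le> r"
    and sum: "sum a {..p} * sum b {..q} * sum c {..r} = 0"
  shows "a 0 * b 0 * c 0 = 0"
proof (rule ccontr)
  note Z = pinwheel_faces_zero [OF assms]
  assume nz: "a 0 * b 0 * c 0 \<noteq> 0"
  have "sum a {..p} = (\<Sum>i\<in>{..p}. if i = 0 then a 0 else 0)"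
    by (rule sum.cong) (use Z(1) [of _ 0] nz ge in auto)
  moreover have "sum b {..q} = (\<Sum>i\<in>{..q}. if i = 0 then b 0 else 0)"
    by (rule sum.cong) (use Z(2) [of 0] nz ge in auto)
  moreover have "sum c {..r} = (\<Sum>i\<in>{..r}. if i = 0 then c 0 else 0)"
    by (rule sum.cong) (use Z(3) [of 0] nz ge in auto)
  ultimately show False using sum nz by simp
qed

lemma pinwheel_shell_zero:
  assumes pw: "pinwheel p q r a b c" and ge: "2 \<le> p" "2 \<le> q" "2 \<le> r"
    and sum: "sum a {..p} * sum b {..q} * sum c {..r} = 0"
    and le: "i \<le> p" "j \<le> q" "k \<le> r"
    and shell: "i = 0 \<or> j = 0 \<or> k = 0 \<or> i = p \<or> j = q \<or> k = r"
  shows "a i * b j * c k = 0"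
proof -
  have sum': "sum (\<lambda>i. a (p - i)) {..p} * sum (\<lambda>i. b (q - i)) {..q} * sum (\<lambda>i. c (r - i)) {..r} = 0"
    using sum by (simp add: sum_reflect)
  note Z = pinwheel_faces_zero [OF pw ge sum]
  note R = pinwheel_faces_zero [OF pinwheel_reflect [OF pw] ge sum']
  note Z0 = pinwheel_corner_zero [OF pw ge sum]
  note R0 = pinwheel_corner_zero [OF pinwheel_reflect [OF pw] ge sum']
  have R1: "a i * b q * c k = 0" if "i < p" "0 < k" "k \<le> r" for i k
    using R(1) [of "p - i" "r - k"] that by simp
  have R2: "a i * b j * c r = 0" if "0 < i" "i \<le> p" "j < q" for i j
    using R(2) [of "p - i" "q - j"] that by simp
  have R3: "a p * b j * c k = 0" if "0 < j" "j \<le> q" "k < r" for j k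
    using R(3) [of "q - j" "r - k"] that by simp
  \<comment> \<open>Six slabs and two corners exhaust the shell: B2, B3 and A1 with the origin come
    directly, the others by reflection.\<close>
  have "0 < i \<and> j = 0 \<and> k < r \<or> i < p \<and> 0 < j \<and> k = 0 \<or> i = 0 \<and> j < q \<and> 0 < k
    \<or> i < p \<and> j = q \<and> 0 < k \<or> 0 < i \<and> j < q \<and> k = r \<or> i = p \<and> 0 < j \<and> k < r
    \<or> i = 0 \<and> j = 0 \<and> k = 0 \<or> i = p \<and> j = q \<and> k = r"
    by (cases "i = 0"; cases "i = p"; cases "j = 0"; cases "j = q"; cases "k = 0"; cases "k = r")
      (use le ge shell in simp_all)
  then consider "0 < i" "j = 0" "k < r" | "i < p" "0 < j" "k = 0" | "i = 0" "j < q" "0 < k"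
    | "i < p" "j = q" "0 < k" | "0 < i" "j < q" "k = r" | "i = p" "0 < j" "k < r"
    | "i = 0" "j = 0" "k = 0" | "i = p" "j = q" "k = r"
    by blast
  then show ?thesis
  proof cases
    case 1
    then show ?thesis using Z(1) [of i k] le by simp
  next
    case 2
    then show ?thesis using Z(2) [of i j] le by simp
  next
    case 3
    then show ?thesis using Z(3) [of j k] le by simp
  next
    case 4
    then show ?thesis using R1 [of i k] le by simp
  next
    case 5
    then show ?thesis using R2 [of i j] le by simp
  next
    case 6
    then show ?thesis using R3 [of j k] le by simp
  next
    case 7
    then show ?thesis using Z0 by simp
  next
    case 8
    then show ?thesis using R0 by simp
  qed
qed

lemma setU_unextendible:
  assumes d: "2 * n + 3 \<le> dA" "2 * n + 3 \<le> dB" "2 * n + 3 \<le> dC"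
    and prod: "is_product3 dA dB dC v"
    and orth: "\<And>\<psi>. \<psi> \<in> setU dA dB dC n \<Longrightarrow> inner3 dA dB dC \<psi> v = 0"
  shows "v = (\<lambda>i j k. 0)"
proof (rule ccontr)
  assume nz: "v \<noteq> (\<lambda>i j k. 0)"
  obtain a b c where supp: "\<And>i. dA \<le> i \<Longrightarrow> a i = 0" "\<And>j. dB \<le> j \<Longrightarrow> b j = 0" "\<And>k. dC \<le> k \<Longrightarrow> c k = 0"
    and v: "v = tensor3 a b c"
    using prod unfolding is_product3_def by blast
  \<comment> \<open>Fixing two coordinates of this point turns the vanishing of the product on a
    shell into the vanishing of one factor at both ends of its range.\<close>
  obtain i0 j0 k0 where nz: "a i0 \<noteq> 0" "b j0 \<noteq> 0" "c k0 \<noteq> 0"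
    using nz unfolding v tensor3_def by (auto simp: fun_eq_iff)
  have amp_v: "amp v (i, j, k) = a i * b j * c k" for i j k
    by (simp add: amp_def v tensor3_def)
  have const: "a x * b y * c z = a x' * b y' * c z'"
    if l: "l \<in> labels n" and c: "(x, y, z) \<in> cells (block dA dB dC n l)" "(x', y', z') \<in> cells (block dA dB dC n l)"
    for l x y z x' y' z'
  proof -
    have "amp v (x, y, z) = amp v (x', y', z')"
    proof (rule bst_const_cnj [OF _ c, where \<phi> = "amp v"])
      fix s assume "s \<in> modes (block dA dB dC n l)" "s \<noteq> (0, 0, 0)"
      then have "bst (block dA dB dC n l) s \<in> setU dA dB dC n"
        unfolding setU_blocks [OF d] bstates_def using l by blast
      from orth [OF this] show "(\<Sum>p\<in>cells (block dA dB dC n l). cnj (amp (bst (block dA dB dC n l) s) p) * amp v p) = 0"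
        by (simp only: inner3_bst [OF cells_block_subset [OF l d]])
    qed
    then show ?thesis by (simp add: amp_v)
  qed
  have "stopper dA dB dC \<in> setU dA dB dC n" by (simp add: setU_def)
  from orth [OF this] have "(\<Sum>p\<in>full dA dB dC. amp v p) = 0"
    unfolding inner3_amp by (simp add: amp_stopper)
  also have "(\<Sum>p\<in>full dA dB dC. amp v p) = (\<Sum>(i, j, k)\<in>{..<dA} \<times> {..<dB} \<times> {..<dC}. a i * b j * c k)"
    by (rule sum.cong) (auto simp: full_def amp_v)
  finally have total: "sum a {..<dA} * sum b {..<dB} * sum c {..<dC} = 0"
    by (simp only: sum_triple)
  have peel: "(\<forall>i. i < t \<or> dA \<le> i + t \<longrightarrow> a i = 0) \<and> (\<forall>j. j < t \<or> dB \<le> j + t \<longrightarrow> b j = 0)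
    \<and> (\<forall>k. k < t \<or> dC \<le> k + t \<longrightarrow> c k = 0)" if "t \<le> n + 1" for t
    using that
  proof (induction t)
    case 0
    then show ?case using supp by simp
  next
    case (Suc t)
    then have IH: "\<And>i. i < t \<or> dA \<le> i + t \<Longrightarrow> a i = 0" "\<And>j. j < t \<or> dB \<le> j + t \<Longrightarrow> b j = 0"
      "\<And>k. k < t \<or> dC \<le> k + t \<Longrightarrow> c k = 0" and t: "t \<le> n" by auto
    have dt: "2 * t + 3 \<le> dA" "2 * t + 3 \<le> dB" "2 * t + 3 \<le> dC" using d t by auto
    \<comment> \<open>Shell t has side lengths p + 1, q + 1, r + 1.\<close>
    define p q r where pqr: "p = dA - 1 - 2 * t" "q = dB - 1 - 2 * t" "r = dC - 1 - 2 * t"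
    have pd: "dA = p + 1 + 2 * t" "dB = q + 1 + 2 * t" "dC = r + 1 + 2 * t" and ge: "2 \<le> p" "2 \<le> q" "2 \<le> r"
      using dt by (simp_all add: pqr)
    have face: "a x * b y * c z = a x' * b y' * c z'"
      if "(x, y, z) \<in> cells (face_box dA dB dC t f)" "(x', y', z') \<in> cells (face_box dA dB dC t f)"
      for f x y z x' y' z'
      by (rule const [of "Some (t, f)"]) (use that t in \<open>auto simp: labels_def simp del: face_box.simps\<close>)
    note fc = face_cells [OF dt]
    have pw: "pinwheel p q r (\<lambda>i. a (t + i)) (\<lambda>j. b (t + j)) (\<lambda>k. c (t + k))"
      unfolding pinwheel_def
      apply (intro conjI)
           apply (intro allI impI; elim conjE; rule face [where f = A1]; simp only: fc; simp add: pd)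
          apply (intro allI impI; elim conjE; rule face [where f = A2]; simp only: fc; simp add: pd)
         apply (intro allI impI; elim conjE; rule face [where f = A3]; simp only: fc; simp add: pd)
        apply (intro allI impI; elim conjE; rule face [where f = B1]; simp only: fc; simp add: pd)
       apply (intro allI impI; elim conjE; rule face [where f = B2]; simp only: fc; simp add: pd)
      apply (intro allI impI; elim conjE; rule face [where f = B3]; simp only: fc; simp add: pd)
      done
    \<comment> \<open>The factors already vanish outside the box of shell t, so the zero entry sum
      given by the stopper passes to that box.\<close>
    have shift: "(\<Sum>x\<le>m. f (t + x)) = sum f {..<m + 1 + 2 * t}"
      if "\<And>i. i < t \<or> m + 1 + 2 * t \<le> i + t \<Longrightarrow> f i = 0" for f :: "nat \<Rightarrow> complex" and m
    proof -
      have "(\<Sum>x\<le>m. f (t + x)) = sum f {t..t + m}"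
        by (rule sum.reindex_bij_witness [of _ "\<lambda>x. x - t" "\<lambda>x. t + x"]) auto
      also have "\<dots> = sum f {..<m + 1 + 2 * t}"
        by (rule sum.mono_neutral_left) (auto intro!: that)
      finally show ?thesis .
    qed
    have tot: "(\<Sum>x\<le>p. a (t + x)) * (\<Sum>x\<le>q. b (t + x)) * (\<Sum>x\<le>r. c (t + x)) = 0"
    proof -
      have "(\<Sum>x\<le>p. a (t + x)) = sum a {..<dA}"
        unfolding pd(1) by (rule shift, rule IH(1)) (simp only: pd(1))
      moreover have "(\<Sum>x\<le>q. b (t + x)) = sum b {..<dB}"
        unfolding pd(2) by (rule shift, rule IH(2)) (simp only: pd(2))
      moreover have "(\<Sum>x\<le>r. c (t + x)) = sum c {..<dC}"
        unfolding pd(3) by (rule shift, rule IH(3)) (simp only: pd(3))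
      ultimately show ?thesis using total by simp
    qed
    have zero: "a i * b j * c k = 0"
      if "t \<le> i" "i + t < dA" "t \<le> j" "j + t < dB" "t \<le> k" "k + t < dC"
        "i = t \<or> j = t \<or> k = t \<or> i + t + 1 = dA \<or> j + t + 1 = dB \<or> k + t + 1 = dC" for i j k
      using pinwheel_shell_zero [OF pw ge tot, of "i - t" "j - t" "k - t"] that pd by auto
    have in_box: "t \<le> i0" "i0 + t < dA" "t \<le> j0" "j0 + t < dB" "t \<le> k0" "k0 + t < dC"
      using IH nz by (meson not_le)+
    have "a i = 0" if "i < Suc t \<or> dA \<le> i + Suc t" for i
      using zero [of i j0 k0] IH(1) [of i] in_box nz that by force
    moreover have "b i = 0" if "i < Suc t \<or> dB \<le> i + Suc t" for i
      using zero [of i0 i k0] IH(2) [of i] in_box nz that by force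
    moreover have "c i = 0" if "i < Suc t \<or> dC \<le> i + Suc t" for i
      using zero [of i0 j0 i] IH(3) [of i] in_box nz that by force
    ultimately show ?case by blast
  qed
  have inside: "n < i \<and> i + n + 1 < dA \<or> a i = 0" "n < i \<and> i + n + 1 < dB \<or> b i = 0"
    "n < i \<and> i + n + 1 < dC \<or> c i = 0" for i
    using peel [of "n + 1"] by (metis add.assoc le_refl less_Suc_eq_le not_le Suc_eq_plus1)+
  have core: "(i0, j0, k0) \<in> cells (block dA dB dC n None)"
    using inside(1) [of i0] inside(2) [of j0] inside(3) [of k0] nz core_cells [OF d] by blast
  \<comment> \<open>Now v lives on the core and is constant there, so its entry sum is a nonzero
    value times the volume, against the stopper.\<close>
  have "(\<Sum>p\<in>full dA dB dC. amp v p) = (\<Sum>p\<in>cells (block dA dB dC n None). amp v p)"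
  proof (rule sum.mono_neutral_right)
    show "cells (block dA dB dC n None) \<subseteq> full dA dB dC"
      by (rule cells_block_subset [OF _ d]) (simp add: labels_def)
    show "\<forall>p\<in>full dA dB dC - cells (block dA dB dC n None). amp v p = 0"
    proof
      fix p assume p: "p \<in> full dA dB dC - cells (block dA dB dC n None)"
      obtain x y z where xyz: "p = (x, y, z)" by (cases p)
      show "amp v p = 0"
        using inside(1) [of x] inside(2) [of y] inside(3) [of z] p core_cells [OF d, of x y z]
        unfolding xyz amp_v by auto
    qed
  qed simp
  also have "\<dots> = (\<Sum>p\<in>cells (block dA dB dC n None). amp v (i0, j0, k0))"
  proof (rule sum.cong [OF refl])
    fix p assume p: "p \<in> cells (block dA dB dC n None)"
    obtain x y z where xyz: "p = (x, y, z)" by (cases p)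
    show "amp v p = amp v (i0, j0, k0)"
      using const [of None x y z i0 j0 k0] p core unfolding xyz amp_v by (simp add: labels_def)
  qed
  also have "\<dots> \<noteq> 0" using core nz by (auto simp: amp_v card_eq_0_iff simp del: block.simps)
  finally show False using \<open>(\<Sum>p\<in>full dA dB dC. amp v p) = 0\<close> by simp
qed

section \<open>Two-party kernels\<close>

text \<open>Inclusive bounds: M and N will be the dimensions minus one, which are also the side
  lengths of the rectangles \<open>low\<close> and \<open>high\<close>.\<close>

definition grid :: "nat \<Rightarrow> nat \<Rightarrow> (nat \<times> nat) set" where
  "grid M N = {..M} \<times> {..N}"

lemma finite_grid [simp]: "finite (grid M N)"
  by (simp add: grid_def)

text \<open>The projection of the outermost slab B3; \<open>high\<close> is that of A3.\<close>

definition low :: "nat \<Rightarrow> nat \<Rightarrow> (nat \<times> nat) set" where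
  "low M N = {..<M} \<times> {0<..N}"

text \<open>The numbers 1 to 4 mark the projections of A1, A2, B1, B2, a planar pinwheel on the
  boundary; 0 is the interior. \<open>low\<close> with the origin is the union of the tiles 0, 1, 2,
  and \<open>high\<close> with (M, N) that of 0, 3, 4.\<close>

definition tile :: "nat \<Rightarrow> nat \<Rightarrow> nat \<times> nat \<Rightarrow> nat" where
  "tile M N = (\<lambda>(j, k). if j = 0 \<and> k < N then 1 else if k = N \<and> j < M then 2
     else if j = M \<and> 0 < k then 3 else if k = 0 \<and> 0 < j then 4 else 0)"

text \<open>Raising x by one trades one summand for another that is a full period away.\<close>

lemma sum_periodic:
  fixes g :: "int \<Rightarrow> complex"
  assumes per: "\<And>a. g (a mod int m) = g a"
  shows "(\<Sum>j<m. g (int x - int j)) = (\<Sum>j<m. g (- int j))"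
proof (induction x)
  case 0
  then show ?case by simp
next
  case (Suc x)
  let ?F = "\<lambda>j. g (int (Suc x) - int j)"
  have "sum ?F {..<m} + ?F m = ?F 0 + (\<Sum>j<m. ?F (Suc j))"
    by (rule trans [OF sum.lessThan_Suc [symmetric] sum.lessThan_Suc_shift])
  moreover have "?F m = ?F 0"
    using per [of "int (Suc x) - int m"] per [of "int (Suc x)"] by (simp add: mod_diff_right_eq [symmetric] mod_diff_left_eq [symmetric])
  ultimately show ?case using Suc by simp
qed

text \<open>The rectangle meets every residue class modulo (M, N) exactly once. Since z > 0, the
  offset in 0 < k \<le> N can be absorbed into z.\<close>

lemma sum_periodic_rect:
  fixes L :: "int \<Rightarrow> int \<Rightarrow> complex"
  assumes per: "\<And>a b. L (a mod int M) (b mod int N) = L a b" and "0 < z"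
  shows "(\<Sum>(j, k)\<in>{..<M} \<times> {0<..N}. L (int x - int j) (int z - int k))
    = (\<Sum>j<M. \<Sum>k<N. L (- int j) (- int k))"
proof -
  have p1: "L (a mod int M) b = L a b" for a b
    using per [of "a mod int M" b] per [of a b] by simp
  have p2: "L a (b mod int N) = L a b" for a b
    using per [of a "b mod int N"] per [of a b] by simp
  have inner: "(\<Sum>k\<in>{0<..N}. L a (int z - int k)) = (\<Sum>k<N. L a (- int k))" for a
  proof -
    have "(\<Sum>k\<in>{0<..N}. L a (int z - int k)) = (\<Sum>k<N. L a (int (z - 1) - int k))"
      by (rule sum.reindex_bij_witness [of _ Suc "\<lambda>k. k - 1"]) (use \<open>0 < z\<close> in \<open>auto simp: of_nat_diff\<close>)
    also have "\<dots> = (\<Sum>k<N. L a (- int k))"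
      by (rule sum_periodic [where g = "L a"]) (rule p2)
    finally show ?thesis .
  qed
  have "(\<Sum>(j, k)\<in>{..<M} \<times> {0<..N}. L (int x - int j) (int z - int k))
    = (\<Sum>j<M. (\<Sum>k<N. L (int x - int j) (- int k)))"
    by (simp add: sum.cartesian_product [symmetric] inner)
  also have "\<dots> = (\<Sum>j<M. \<Sum>k<N. L (- int j) (- int k))"
    by (rule sum_periodic [where g = "\<lambda>a. \<Sum>k<N. L a (- int k)"]) (simp add: p1)
  finally show ?thesis .
qed

definition shift_kernel :: "(int \<Rightarrow> int \<Rightarrow> complex) \<Rightarrow> nat \<times> nat \<Rightarrow> nat \<times> nat \<Rightarrow> complex" where
  "shift_kernel L p q = L (int (fst p) - int (fst q)) (int (snd p) - int (snd q))"

lemma tile_cross: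
  assumes "p \<in> insert (0, 0) (low M N)" "q \<in> grid M N" "q \<notin> insert (0, 0) (low M N)"
    "2 \<le> M" "2 \<le> N"
  shows "tile M N p \<noteq> tile M N q"
  using assms by (cases p; cases q) (auto simp: tile_def grid_def low_def)

text \<open>Summing the convolution identity over q' in \<open>low\<close> turns its q' terms into
  row sums. Those of the kernel agree by periodicity. Those of E over the whole grid agree by
  hypothesis, and outside \<open>low\<close> only the entry at the origin survives the tile
  condition. The row term is thus traded for the single unknown E p (0, 0).\<close>

lemma kernel_rows:
  fixes E :: "nat \<times> nat \<Rightarrow> nat \<times> nat \<Rightarrow> complex"
  assumes ge: "2 \<le> M" "2 \<le> N"
    and tiles: "\<And>y y'. y \<in> grid M N \<Longrightarrow> y' \<in> grid M N \<Longrightarrow> tile M N y \<noteq> tile M N y' \<Longrightarrow> E y y' = 0"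
    and rows: "\<And>y y'. y \<in> low M N \<Longrightarrow> y' \<in> low M N \<Longrightarrow> sum (E y) (grid M N) = sum (E y') (grid M N)"
    and per: "\<And>a b. L (a mod int M) (b mod int N) = L a b"
    and conv: "\<And>p q p' q'. p \<in> low M N \<Longrightarrow> q \<in> low M N \<Longrightarrow> p' \<in> low M N \<Longrightarrow> q' \<in> low M N \<Longrightarrow>
      E p p' - E q p' - E p q' + E q q'
      = shift_kernel L p p' - shift_kernel L q p' - shift_kernel L p q' + shift_kernel L q q'"
    and K: "p \<in> low M N" "q \<in> low M N" "p' \<in> low M N"
  shows "of_nat (M * N) * (E p p' - E q p') + (E p (0, 0) - E q (0, 0))
    = of_nat (M * N) * (shift_kernel L p p' - shift_kernel L q p')"
proof -
  let ?K = "low M N" and ?c = "of_nat (M * N) :: complex"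
  have card: "of_nat (card ?K) = ?c" by (simp add: low_def card_cartesian_product)
  have fin: "finite ?K" by (simp add: low_def)
  have row: "sum (E p) (grid M N) = E p (0, 0) + sum (E p) ?K" if "p \<in> ?K" for p
  proof -
    have "sum (E p) (grid M N) = sum (E p) (insert (0, 0) ?K)"
    proof (rule sum.mono_neutral_right)
      show "\<forall>q\<in>grid M N - insert (0, 0) ?K. E p q = 0"
      proof
        fix q assume q: "q \<in> grid M N - insert (0, 0) ?K"
        show "E p q = 0"
          by (rule tiles) (use q that ge tile_cross [of p M N q] in \<open>auto simp: grid_def low_def\<close>)
      qed
    qed (auto simp: grid_def low_def)
    then show ?thesis by (simp add: low_def)
  qed
  have Lsum: "(\<Sum>q'\<in>?K. shift_kernel L p q') = (\<Sum>j<M. \<Sum>k<N. L (- int j) (- int k))" if "p \<in> ?K" for p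
    using that sum_periodic_rect [of L M N, OF per, of "snd p" "fst p"]
    by (simp add: low_def shift_kernel_def case_prod_beta' mem_Times_iff)
  have "(\<Sum>q'\<in>?K. E p p' - E q p' - E p q' + E q q')
    = (\<Sum>q'\<in>?K. shift_kernel L p p' - shift_kernel L q p' - shift_kernel L p q' + shift_kernel L q q')"
    by (rule sum.cong [OF refl]) (rule conv [OF K])
  then have "?c * (E p p' - E q p') - sum (E p) ?K + sum (E q) ?K
    = ?c * (shift_kernel L p p' - shift_kernel L q p')"
    by (simp add: sum.distrib sum_subtractf card Lsum K right_diff_distrib)
  moreover have "sum (E p) ?K = sum (E p) (grid M N) - E p (0, 0)" "sum (E q) ?K = sum (E q) (grid M N) - E q (0, 0)"
    by (simp_all add: row K)
  ultimately show ?thesis using rows [OF K(1,2)] by (simp add: algebra_simps)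
qed

text \<open>The argument takes two rounds, since the origin entries in \<open>kernel_rows\<close>
  are at first known to vanish only for p outside tile 1. On those p, E is the kernel plus a
  constant e. This fixes L at all displacements whose second component is nonzero modulo N, which
  yields the origin entries for tile 1 as well, and the comparison is repeated on all of
  \<open>low\<close>.\<close>

lemma kernel_scalar_half:
  fixes E :: "nat \<times> nat \<Rightarrow> nat \<times> nat \<Rightarrow> complex"
  assumes ge: "2 \<le> M" "2 \<le> N"
    and tiles: "\<And>y y'. y \<in> grid M N \<Longrightarrow> y' \<in> grid M N \<Longrightarrow> tile M N y \<noteq> tile M N y' \<Longrightarrow> E y y' = 0"
    and rows: "\<And>y y'. y \<in> low M N \<Longrightarrow> y' \<in> low M N \<Longrightarrow> sum (E y) (grid M N) = sum (E y') (grid M N)"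
    and row0: "sum (E (0, 0)) (grid M N) = sum (E (0, 1)) (grid M N)"
    and cols: "\<And>y y'. y \<in> low M N \<Longrightarrow> y' \<in> low M N \<Longrightarrow> (\<Sum>w\<in>grid M N. E w y) = (\<Sum>w\<in>grid M N. E w y')"
    and per: "\<And>a b. L (a mod int M) (b mod int N) = L a b"
    and conv: "\<And>p q p' q'. p \<in> low M N \<Longrightarrow> q \<in> low M N \<Longrightarrow> p' \<in> low M N \<Longrightarrow> q' \<in> low M N \<Longrightarrow>
      E p p' - E q p' - E p q' + E q q'
      = shift_kernel L p p' - shift_kernel L q p' - shift_kernel L p q' + shift_kernel L q q'"
  shows "\<exists>h. \<forall>y\<in>insert (0, 0) (low M N). \<forall>y'\<in>insert (0, 0) (low M N). E y y' = (if y = y' then h else 0)"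
proof -
  let ?K = "low M N" and ?S = "shift_kernel L" and ?c = "of_nat (M * N) :: complex"
  have c: "?c \<noteq> 0" using ge by simp
  have KJ: "p \<in> grid M N" if "p \<in> ?K" for p using that by (auto simp: grid_def low_def)
  have oJ: "(0, 0) \<in> grid M N" by (simp add: grid_def)
  have M1: "?c * (E p p' - E q p') + (E p (0, 0) - E q (0, 0)) = ?c * (?S p p' - ?S q p')"
    if "p \<in> ?K" "q \<in> ?K" "p' \<in> ?K" for p q p'
    using kernel_rows [of M N E L] ge tiles rows per conv that by blast
  \<comment> \<open>The transpose of E satisfies the same hypotheses with the reflected kernel L (-
    a) (- b).\<close>
  have M2: "?c * (E p p' - E p q') + (E (0, 0) p' - E (0, 0) q') = ?c * (?S p p' - ?S p q')"
    if "p \<in> ?K" "p' \<in> ?K" "q' \<in> ?K" for p p' q'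
  proof -
    have sw: "shift_kernel (\<lambda>a b. L (- a) (- b)) p q = ?S q p" for p q
      by (simp add: shift_kernel_def)
    have per': "L (- (a mod int M)) (- (b mod int N)) = L (- a) (- b)" for a b
      using per [of "- (a mod int M)" "- (b mod int N)"] per [of "- a" "- b"] by (simp add: mod_minus_eq)
    have conv': "E p' p - E p' q - E q' p + E q' q
      = shift_kernel (\<lambda>a b. L (- a) (- b)) p p' - shift_kernel (\<lambda>a b. L (- a) (- b)) q p'
       - shift_kernel (\<lambda>a b. L (- a) (- b)) p q' + shift_kernel (\<lambda>a b. L (- a) (- b)) q q'"
      if "p \<in> ?K" "q \<in> ?K" "p' \<in> ?K" "q' \<in> ?K" for p q p' q'
      unfolding sw using conv [of p' q' p q] that by (simp add: algebra_simps)
    have tiles': "E y' y = 0" if "y \<in> grid M N" "y' \<in> grid M N" "tile M N y \<noteq> tile M N y'" for y y'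
      using tiles [of y' y] that by metis
    have "?c * (E p p' - E p q') + (E (0, 0) p' - E (0, 0) q')
      = ?c * (shift_kernel (\<lambda>a b. L (- a) (- b)) p' p - shift_kernel (\<lambda>a b. L (- a) (- b)) q' p)"
      by (rule kernel_rows [of M N "\<lambda>y y'. E y' y" "\<lambda>a b. L (- a) (- b)" p' q' p, OF ge])
        (use tiles' cols per' conv' that in blast)+
    then show ?thesis by (simp only: sw)
  qed
  \<comment> \<open>The origin lies in tile 1, so its entries with points of Q vanish.\<close>
  define Q where "Q = {p \<in> ?K. tile M N p \<noteq> 1}"
  have t0: "tile M N (0, 0) = 1" using ge by (simp add: tile_def)
  have Qo: "E p (0, 0) = 0" "E (0, 0) p = 0" if "p \<in> Q" for p
    using that tiles [of p "(0, 0)"] tiles [of "(0, 0)" p] KJ oJ by (auto simp: Q_def t0)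
  have QK: "p \<in> ?K" if "p \<in> Q" for p using that by (simp add: Q_def)
  \<comment> \<open>A base point, in tile 2, that fixes the additive constant e.\<close>
  define b where "b = (1::nat, N)"
  have b: "b \<in> Q" using ge by (auto simp: Q_def low_def b_def tile_def)
  define e where "e = E b b - ?S b b"
  have EQ: "E p p' = ?S p p' + e" if "p \<in> Q" "p' \<in> Q" for p p'
  proof -
    have "?c * (E p p' - E b p') = ?c * (?S p p' - ?S b p')"
      using M1 [of p b p'] that b Qo QK by simp
    then have 1: "E p p' - E b p' = ?S p p' - ?S b p'" using c by (metis mult_left_cancel)
    have "?c * (E b p' - E b b) = ?c * (?S b p' - ?S b b)"
      using M2 [of b p' b] that b Qo QK by simp
    then have 2: "E b p' - E b b = ?S b p' - ?S b b" using c by (metis mult_left_cancel)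
    have "E p p' = (E p p' - E b p') + (E b p' - E b b) + E b b" by simp
    also have "\<dots> = ?S p p' + e" unfolding 1 2 by (simp add: e_def)
    finally show ?thesis .
  qed
  have L_off: "L x z = - e" if "z mod int N \<noteq> 0" for x z
  proof -
    define \<alpha> where "\<alpha> = nat (x mod int M)"
    define \<beta> where "\<beta> = nat (z mod int N)"
    have \<alpha>: "int \<alpha> = x mod int M" "\<alpha> < M" using ge by (auto simp: \<alpha>_def nat_less_iff)
    have \<beta>: "int \<beta> = z mod int N" "\<beta> < N" using ge by (auto simp: \<beta>_def nat_less_iff)
    have \<beta>0: "0 < \<beta>" using \<beta> that by (cases \<beta>) auto
    \<comment> \<open>Here x1 is \<alpha> + 1 modulo M, so (x1, N) and (1, N - \<beta>) realize the
      displacement (\<alpha>, \<beta>) modulo M. The first point is in tile 2 and the second in the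
      interior, so E vanishes on the pair.\<close>
    define x1 where "x1 = (if \<alpha> + 1 < M then \<alpha> + 1 else 0)"
    have x1: "(int x1 - 1) mod int M = int \<alpha>"
    proof (cases "\<alpha> + 1 < M")
      case True
      then show ?thesis using \<alpha> by (simp add: x1_def)
    next
      case False
      then have "int \<alpha> = int M - 1" using \<alpha> by simp
      then show ?thesis using False ge by (simp add: x1_def zmod_minus1)
    qed
    have p: "(x1, N) \<in> Q" "(1, N - \<beta>) \<in> Q" "tile M N (x1, N) \<noteq> tile M N (1, N - \<beta>)"
      using ge \<alpha> \<beta> \<beta>0 by (auto simp: Q_def low_def tile_def x1_def)
    have "0 = ?S (x1, N) (1, N - \<beta>) + e"
      using EQ [OF p(1,2)] tiles [OF KJ [OF QK [OF p(1)]] KJ [OF QK [OF p(2)]] p(3)] by simp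
    also have "?S (x1, N) (1, N - \<beta>) = L (int x1 - 1) (int \<beta>)"
      using \<beta> by (simp add: shift_kernel_def of_nat_diff)
    also have "\<dots> = L x z"
      using per [of "int x1 - 1" "int \<beta>"] per [of x z] x1 \<alpha> \<beta> by simp
    finally show ?thesis by (simp add: eq_neg_iff_add_eq_0)
  qed
  have S_off: "?S p p' = - e" if "p \<in> ?K" "p' \<in> ?K" "snd p \<noteq> snd p'" for p p'
    unfolding shift_kernel_def
  proof (rule L_off)
    have "0 < snd p" "snd p \<le> N" "0 < snd p'" "snd p' \<le> N" using that by (auto simp: low_def)
    then have "\<bar>int (snd p) - int (snd p')\<bar> < int N" by linarith
    then show "(int (snd p) - int (snd p')) mod int N \<noteq> 0"
      using that(3) by (metis dvd_imp_le_int abs_of_nat diff_0_right dvd_eq_mod_eq_0 eq_iff_diff_eq_0 not_le of_nat_eq_iff)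
  qed
  have oK: "E p (0, 0) = 0 \<and> E (0, 0) p = 0" if p: "p \<in> ?K" for p
  proof (cases "p \<in> Q")
    case True
    then show ?thesis using Qo by simp
  next
    case False
    then have "tile M N p = 1" using p by (simp add: Q_def)
    then obtain k where k: "p = (0, k)" "0 < k" "k < N"
      using p by (cases p) (auto simp: tile_def low_def split: if_splits)
    \<comment> \<open>The point (0, k) of tile 1 and its interior neighbour (1, k) are both compared
      with (0, N) of tile 2. There E vanishes and the kernel values agree, so both have the same
      origin entries, and those of (1, k) are zero.\<close>
    have q: "(1, k) \<in> Q" and r: "(0, N) \<in> Q" and pK: "(0, k) \<in> ?K"
      using k ge by (auto simp: Q_def low_def tile_def)
    have tl: "tile M N (0, k) \<noteq> tile M N (0, N)" "tile M N (1, k) \<noteq> tile M N (0, N)"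
      using k ge by (auto simp: tile_def)
    have z: "E (0, k) (0, N) = 0" "E (1, k) (0, N) = 0" "E (0, N) (0, k) = 0" "E (0, N) (1, k) = 0"
      using tiles [OF KJ KJ] tl tl [symmetric] pK QK [OF q] QK [OF r] by simp_all
    have s: "?S (0, k) (0, N) = - e" "?S (1, k) (0, N) = - e" "?S (0, N) (0, k) = - e" "?S (0, N) (1, k) = - e"
      using S_off pK QK [OF q] QK [OF r] k by simp_all
    show ?thesis
      using M1 [OF pK QK [OF q] QK [OF r], unfolded z s] M2 [OF QK [OF r] pK QK [OF q], unfolded z s]
        Qo [OF q] k by simp
  qed
  have EK: "E p p' = ?S p p' + e" if "p \<in> ?K" "p' \<in> ?K" for p p'
  proof -
    have "?c * (E p p' - E b p') = ?c * (?S p p' - ?S b p')"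
      using M1 [of p b p'] that QK [OF b] oK by simp
    then have 1: "E p p' - E b p' = ?S p p' - ?S b p'" using c by (metis mult_left_cancel)
    have "?c * (E b p' - E b b) = ?c * (?S b p' - ?S b b)"
      using M2 [of b p' b] that QK [OF b] oK by simp
    then have 2: "E b p' - E b b = ?S b p' - ?S b b" using c by (metis mult_left_cancel)
    have "E p p' = (E p p' - E b p') + (E b p' - E b b) + E b b" by simp
    also have "\<dots> = ?S p p' + e" unfolding 1 2 by (simp add: e_def)
    finally show ?thesis .
  qed
  define h where "h = L 0 0 + e"
  have offK: "E p p' = 0" if pK: "p \<in> ?K" "p' \<in> ?K" "p \<noteq> p'" for p p'
  proof (cases "snd p = snd p'")
    case False
    then show ?thesis using EK S_off pK by simp
  next
    case True
    define \<alpha> where "\<alpha> = nat ((int (fst p) - int (fst p')) mod int M)"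
    have \<alpha>: "int \<alpha> = (int (fst p) - int (fst p')) mod int M" "\<alpha> < M"
      using ge by (auto simp: \<alpha>_def nat_less_iff)
    have "fst p \<noteq> fst p'" using True pK(3) by (simp add: prod_eq_iff)
    moreover have "\<bar>int (fst p) - int (fst p')\<bar> < int M" using pK by (auto simp: low_def)
    ultimately have "(int (fst p) - int (fst p')) mod int M \<noteq> 0"
      by (metis dvd_imp_le_int abs_of_nat diff_0_right dvd_eq_mod_eq_0 eq_iff_diff_eq_0 not_le of_nat_eq_iff)
    then have \<alpha>0: "0 < \<alpha>" using \<alpha> by (cases \<alpha>) auto
    \<comment> \<open>The remaining displacements (\<alpha>, 0) occur between an interior point and
      one of tile 1.\<close>
    have q: "(\<alpha>, 1) \<in> ?K" "(0, 1) \<in> ?K" "tile M N (\<alpha>, 1) \<noteq> tile M N (0, 1)"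
      using \<alpha> \<alpha>0 ge by (auto simp: low_def tile_def)
    have "0 = ?S (\<alpha>, 1) (0, 1) + e"
      using EK [OF q(1,2)] tiles [OF KJ [OF q(1)] KJ [OF q(2)] q(3)] by simp
    also have "?S (\<alpha>, 1) (0, 1) = L (int \<alpha>) 0" by (simp add: shift_kernel_def)
    also have "\<dots> = ?S p p'"
      using per [of "int \<alpha>" 0] per [of "int (fst p) - int (fst p')" 0] \<alpha> True by (simp add: shift_kernel_def)
    finally show ?thesis using EK pK by simp
  qed
  have diagK: "E p p = h" if "p \<in> ?K" for p
    using EK [OF that that] by (simp add: h_def shift_kernel_def)
  have E00: "E (0, 0) (0, 0) = h"
  proof -
    \<comment> \<open>All off-diagonal entries in these rows vanish, so the equal row sums of the
      origin and (0, 1) are diagonal entries.\<close>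
    have one: "sum (E p) (grid M N) = E p p" if "p \<in> insert (0, 0) ?K" for p
    proof -
      have "E p q = 0" if q: "q \<in> grid M N - {p}" for q
      proof (cases "q \<in> insert (0, 0) ?K")
        case True
        then show ?thesis using \<open>p \<in> _\<close> q offK [of p q] oK [of p] oK [of q] by auto
      next
        case False
        then show ?thesis
          using tiles [of p q] tile_cross [of p M N q] \<open>p \<in> insert (0, 0) ?K\<close> q ge KJ oJ by (auto simp: low_def grid_def)
      qed
      moreover have "p \<in> grid M N" using that KJ [of p] oJ by auto
      ultimately have "sum (E p) (grid M N) = sum (E p) {p}"
        by (intro sum.mono_neutral_right) simp_all
      then show ?thesis by simp
    qed
    have "(0, 1) \<in> ?K" using ge by (simp add: low_def)
    then show ?thesis using row0 one [of "(0, 0)"] one [of "(0, 1)"] diagK by simp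
  qed
  have "E y y' = (if y = y' then h else 0)" if "y \<in> insert (0, 0) ?K" "y' \<in> insert (0, 0) ?K" for y y'
    using that E00 diagK offK oK by (cases "y = (0, 0)"; cases "y' = (0, 0)") auto
  then show ?thesis by blast
qed

definition high :: "nat \<Rightarrow> nat \<Rightarrow> (nat \<times> nat) set" where
  "high M N = {0<..M} \<times> {..<N}"

text \<open>The second half follows from the first by the point reflection of the grid, which
  preserves the tiling.\<close>

lemma kernel_scalar:
  fixes E :: "nat \<times> nat \<Rightarrow> nat \<times> nat \<Rightarrow> complex"
  assumes ge: "2 \<le> M" "2 \<le> N"
    and tiles: "\<And>y y'. y \<in> grid M N \<Longrightarrow> y' \<in> grid M N \<Longrightarrow> tile M N y \<noteq> tile M N y' \<Longrightarrow> E y y' = 0"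
    and rows_low: "\<And>y y'. y \<in> low M N \<Longrightarrow> y' \<in> low M N \<Longrightarrow> sum (E y) (grid M N) = sum (E y') (grid M N)"
    and rows_high: "\<And>y y'. y \<in> high M N \<Longrightarrow> y' \<in> high M N \<Longrightarrow> sum (E y) (grid M N) = sum (E y') (grid M N)"
    and row_corner: "sum (E (0, 0)) (grid M N) = sum (E (0, 1)) (grid M N)"
      "sum (E (M, N)) (grid M N) = sum (E (M, N - 1)) (grid M N)"
    and cols_low: "\<And>y y'. y \<in> low M N \<Longrightarrow> y' \<in> low M N \<Longrightarrow>
      (\<Sum>w\<in>grid M N. E w y) = (\<Sum>w\<in>grid M N. E w y')"
    and cols_high: "\<And>y y'. y \<in> high M N \<Longrightarrow> y' \<in> high M N \<Longrightarrow>
      (\<Sum>w\<in>grid M N. E w y) = (\<Sum>w\<in>grid M N. E w y')"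
    and conv_low: "\<exists>L. (\<forall>a b. L (a mod int M) (b mod int N) = L a b) \<and>
      (\<forall>p\<in>low M N. \<forall>q\<in>low M N. \<forall>p'\<in>low M N. \<forall>q'\<in>low M N. E p p' - E q p' - E p q' + E q q'
        = shift_kernel L p p' - shift_kernel L q p' - shift_kernel L p q' + shift_kernel L q q')"
    and conv_high: "\<exists>L. (\<forall>a b. L (a mod int M) (b mod int N) = L a b) \<and>
      (\<forall>p\<in>high M N. \<forall>q\<in>high M N. \<forall>p'\<in>high M N. \<forall>q'\<in>high M N. E p p' - E q p' - E p q' + E q q'
        = shift_kernel L p p' - shift_kernel L q p' - shift_kernel L p q' + shift_kernel L q q')"
  shows "\<exists>h. \<forall>y\<in>grid M N. \<forall>y'\<in>grid M N. E y y' = (if y = y' then h else 0)"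
proof -
  define \<rho> :: "nat \<times> nat \<Rightarrow> nat \<times> nat" where "\<rho> = (\<lambda>(j, k). (M - j, N - k))"
  have \<rho>\<rho>: "\<rho> (\<rho> y) = y" if "y \<in> grid M N" for y using that by (auto simp: \<rho>_def grid_def)
  have \<rho>_grid: "\<rho> y \<in> grid M N" if "y \<in> grid M N" for y using that by (auto simp: \<rho>_def grid_def)
  have \<rho>_low: "\<rho> y \<in> high M N" if "y \<in> low M N" for y
    using that ge by (auto simp: \<rho>_def low_def high_def)
  have \<rho>_high: "\<rho> y \<in> low M N" if "y \<in> high M N" for y
    using that ge by (auto simp: \<rho>_def low_def high_def)
  have low_grid: "y \<in> grid M N" if "y \<in> low M N" for y using that by (auto simp: low_def grid_def)
  have high_grid: "y \<in> grid M N" if "y \<in> high M N" for y using that by (auto simp: high_def grid_def)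
  \<comment> \<open>The list is the permutation of tile numbers that exchanges 1 with 3 and 2 with
    4.\<close>
  have \<rho>_tile: "tile M N (\<rho> y) = [0, 3, 4, 1, 2] ! tile M N y" if "y \<in> grid M N" for y
    using that ge by (cases y) (auto simp: \<rho>_def grid_def tile_def)
  have tile_le: "tile M N y < 5" for y by (cases y) (simp add: tile_def)
  have \<rho>_tiles: "tile M N (\<rho> y) \<noteq> tile M N (\<rho> y')" if "y \<in> grid M N" "y' \<in> grid M N" "tile M N y \<noteq> tile M N y'" for y y'
  proof -
    have d: "distinct [0, 3, 4, 1, 2::nat]" by simp
    have l: "tile M N w < length [0, 3, 4, 1, 2::nat]" for w using tile_le [of w] by simp
    show ?thesis
      unfolding \<rho>_tile [OF that(1)] \<rho>_tile [OF that(2)] nth_eq_iff_index_eq [OF d l l] by (rule that(3))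
  qed
  have sum_\<rho>: "(\<Sum>w\<in>grid M N. f (\<rho> w)) = sum f (grid M N)" for f :: "nat \<times> nat \<Rightarrow> complex"
    by (rule sum.reindex_bij_witness [of _ \<rho> \<rho>]) (auto simp: \<rho>\<rho> \<rho>_grid)
  define R where "R y y' = E (\<rho> y) (\<rho> y')" for y y'
  have sum_R: "sum (R y) (grid M N) = sum (E (\<rho> y)) (grid M N)" for y
    unfolding R_def by (rule sum_\<rho>)
  have sum_R': "(\<Sum>w\<in>grid M N. R w y) = (\<Sum>w\<in>grid M N. E w (\<rho> y))" for y
    unfolding R_def by (rule sum_\<rho>)
  obtain L where L: "\<And>a b. L (a mod int M) (b mod int N) = L a b"
    "\<And>p q p' q'. p \<in> low M N \<Longrightarrow> q \<in> low M N \<Longrightarrow> p' \<in> low M N \<Longrightarrow> q' \<in> low M N \<Longrightarrow>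
      E p p' - E q p' - E p q' + E q q'
      = shift_kernel L p p' - shift_kernel L q p' - shift_kernel L p q' + shift_kernel L q q'"
    using conv_low by blast
  obtain h where h: "\<And>y y'. y \<in> insert (0, 0) (low M N) \<Longrightarrow> y' \<in> insert (0, 0) (low M N) \<Longrightarrow>
      E y y' = (if y = y' then h else 0)"
    using kernel_scalar_half [OF ge tiles rows_low row_corner(1) cols_low L] by blast
  obtain L' where L': "\<And>a b. L' (a mod int M) (b mod int N) = L' a b"
    "\<And>p q p' q'. p \<in> high M N \<Longrightarrow> q \<in> high M N \<Longrightarrow> p' \<in> high M N \<Longrightarrow> q' \<in> high M N \<Longrightarrow>
      E p p' - E q p' - E p q' + E q q'
      = shift_kernel L' p p' - shift_kernel L' q p' - shift_kernel L' p q' + shift_kernel L' q q'"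
    using conv_high by blast
  have sk: "shift_kernel (\<lambda>a b. L' (- a) (- b)) p q = shift_kernel L' (\<rho> p) (\<rho> q)"
    if "p \<in> low M N" "q \<in> low M N" for p q
    using that by (cases p; cases q) (auto simp: shift_kernel_def \<rho>_def low_def of_nat_diff algebra_simps)
  have "\<exists>h. \<forall>y\<in>insert (0, 0) (low M N). \<forall>y'\<in>insert (0, 0) (low M N). R y y' = (if y = y' then h else 0)"
  proof (rule kernel_scalar_half [OF ge, where L = "\<lambda>a b. L' (- a) (- b)"])
    show "R y y' = 0" if "y \<in> grid M N" "y' \<in> grid M N" "tile M N y \<noteq> tile M N y'" for y y'
      unfolding R_def by (rule tiles [OF \<rho>_grid \<rho>_grid \<rho>_tiles]) (fact that)+
    show "sum (R y) (grid M N) = sum (R y') (grid M N)" if "y \<in> low M N" "y' \<in> low M N" for y y'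
      unfolding sum_R by (rule rows_high [OF \<rho>_low \<rho>_low]) (fact that)+
    show "sum (R (0, 0)) (grid M N) = sum (R (0, 1)) (grid M N)"
      unfolding sum_R using row_corner(2) by (simp add: \<rho>_def)
    show "(\<Sum>w\<in>grid M N. R w y) = (\<Sum>w\<in>grid M N. R w y')" if "y \<in> low M N" "y' \<in> low M N" for y y'
      unfolding sum_R' by (rule cols_high [OF \<rho>_low \<rho>_low]) (fact that)+
    show "L' (- (a mod int M)) (- (b mod int N)) = L' (- a) (- b)" for a b
      using L'(1) [of "- (a mod int M)" "- (b mod int N)"] L'(1) [of "- a" "- b"] by (simp add: mod_minus_eq)
    show "R p p' - R q p' - R p q' + R q q' =
      shift_kernel (\<lambda>a b. L' (- a) (- b)) p p' - shift_kernel (\<lambda>a b. L' (- a) (- b)) q p'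
      - shift_kernel (\<lambda>a b. L' (- a) (- b)) p q' + shift_kernel (\<lambda>a b. L' (- a) (- b)) q q'"
      if "p \<in> low M N" "q \<in> low M N" "p' \<in> low M N" "q' \<in> low M N" for p q p' q'
      using L'(2) [of "\<rho> p" "\<rho> q" "\<rho> p'" "\<rho> q'"] that by (simp add: \<rho>_low sk R_def)
  qed
  then obtain h' where h': "\<And>y y'. y \<in> insert (0, 0) (low M N) \<Longrightarrow> y' \<in> insert (0, 0) (low M N) \<Longrightarrow>
      R y y' = (if y = y' then h' else 0)" by blast
  have high: "E y y' = (if y = y' then h' else 0)"
    if "y \<in> insert (M, N) (high M N)" "y' \<in> insert (M, N) (high M N)" for y y'
  proof -
    have "(M, N) \<in> grid M N" by (simp add: grid_def)
    then have g: "y \<in> grid M N" "y' \<in> grid M N" using that high_grid by blast+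
    have "\<rho> y \<in> insert (0, 0) (low M N)" "\<rho> y' \<in> insert (0, 0) (low M N)"
      using that \<rho>_high [of y] \<rho>_high [of y'] by (auto simp: \<rho>_def)
    from h' [OF this] show ?thesis using \<rho>\<rho> [OF g(1)] \<rho>\<rho> [OF g(2)] by (auto simp: R_def)
  qed
  \<comment> \<open>The point (1, 1) lies in both rectangles.\<close>
  have "h' = h"
    using high [of "(1, 1)" "(1, 1)"] h [of "(1, 1)" "(1, 1)"] ge by (simp add: high_def low_def)
  have "E y y' = (if y = y' then h else 0)" if y: "y \<in> grid M N" "y' \<in> grid M N" for y y'
  proof (cases "tile M N y = tile M N y'")
    case False
    then show ?thesis using tiles [OF y] by auto
  next
    case True
    \<comment> \<open>Points of the same tile lie in the same half, so each pair not separated by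
      the tiles is covered by \<open>h\<close> or by \<open>high\<close>.\<close>
    have mem: "w \<in> (if tile M N w \<in> {3, 4} then insert (M, N) (high M N) else insert (0, 0) (low M N))"
      if "w \<in> grid M N" for w
      using that ge by (cases w) (auto simp: tile_def grid_def high_def low_def)
    show ?thesis
    proof (cases "tile M N y \<in> {3, 4}")
      case True
      then show ?thesis
        using high [of y y'] mem [OF y(1)] mem [OF y(2)] \<open>tile M N y = _\<close> \<open>h' = h\<close> by simp
    next
      case False
      then show ?thesis
        using h [of y y'] mem [OF y(1)] mem [OF y(2)] \<open>tile M N y = _\<close> by simp
    qed
  qed
  then show ?thesis by blast
qed

section \<open>Fourier-diagonal forms as convolution kernels\<close>

lemma fvec_mult_cnj:
  assumes "x \<in> {lo..<lo + m}" "y \<in> {lo..<lo + m}"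
  shows "fvec lo m s x * cnj (fvec lo m s y) = cis (2 * pi * real s * of_int (int x - int y) / real m)"
  using assms
  by (simp add: fvec_def omega_def DeMoivre cis_cnj cis_mult of_nat_diff diff_divide_distrib [symmetric] algebra_simps)

text \<open>The frequency s is an integer, so passing to the residue changes the phase by a multiple
  of 2 pi. This makes the kernel periodic.\<close>

lemma cis_mod:
  assumes "0 < m"
  shows "cis (2 * pi * real s * of_int (a mod int m) / real m) = cis (2 * pi * real s * of_int a / real m)"
proof -
  have "real_of_int a = of_int (a div int m) * real m + of_int (a mod int m)"
    by (metis div_mult_mod_eq of_int_add of_int_mult of_int_of_nat_eq)
  then have "2 * pi * real s * of_int a / real m
    = 2 * pi * of_int (int s * (a div int m)) + 2 * pi * real s * of_int (a mod int m) / real m"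
    using assms by (simp add: field_simps)
  then have "cis (2 * pi * real s * of_int a / real m)
    = cis (2 * pi * of_int (int s * (a div int m))) * cis (2 * pi * real s * of_int (a mod int m) / real m)"
    by (simp only: cis_mult)
  also have "cis (2 * pi * of_int (int s * (a div int m))) = 1"
    by (rule cis_multiple_2pi) simp
  finally show ?thesis by simp
qed

text \<open>In each mode, an amplitude times a conjugated amplitude depends only on the difference
  of the positions, so the diagonal part from \<open>bst_diagonal\<close> is a convolution. The side
  of length one contributes only the frequency 0.\<close>

lemma bst_shift_kernel:
  assumes \<beta>: "\<beta> = ((a, 1), (b, M), (c, N))" and pos: "0 < M" "0 < N"
    and ker: "\<And>s s'. s \<in> modes \<beta> - {(0, 0, 0)} \<Longrightarrow> s' \<in> modes \<beta> - {(0, 0, 0)} \<Longrightarrow> s \<noteq> s' \<Longrightarrow>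
      (\<Sum>p\<in>cells \<beta>. \<Sum>p'\<in>cells \<beta>. cnj (amp (bst \<beta> s) p) * W p p' * amp (bst \<beta> s') p') = 0"
  shows "\<exists>L. (\<forall>x y. L (x mod int M) (y mod int N) = L x y) \<and>
    (\<forall>p q p' q'. (a, p) \<in> cells \<beta> \<longrightarrow> (a, q) \<in> cells \<beta> \<longrightarrow> (a, p') \<in> cells \<beta> \<longrightarrow> (a, q') \<in> cells \<beta> \<longrightarrow>
      W (a, p) (a, p') - W (a, q) (a, p') - W (a, p) (a, q') + W (a, q) (a, q')
      = shift_kernel L p p' - shift_kernel L q p' - shift_kernel L p q' + shift_kernel L q q')"
proof -
  obtain l where l: "\<And>p q p' q'. p \<in> cells \<beta> \<Longrightarrow> q \<in> cells \<beta> \<Longrightarrow> p' \<in> cells \<beta> \<Longrightarrow> q' \<in> cells \<beta> \<Longrightarrow>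
    (let L = \<lambda>p p'. \<Sum>s\<in>modes \<beta>. l s * (amp (bst \<beta> s) p * cnj (amp (bst \<beta> s) p')) in
     W p p' - W q p' - W p q' + W q q' = L p p' - L q p' - L p q' + L q q')"
    using bst_diagonal [OF ker] by blast
  define L where "L x y = (\<Sum>(i, j, k)\<in>modes \<beta>. l (i, j, k) *
    (cis (2 * pi * real j * of_int x / real M) * cis (2 * pi * real k * of_int y / real N)))" for x y
  have "L (x mod int M) (y mod int N) = L x y" for x y
    unfolding L_def by (simp only: cis_mod pos)
  moreover have L: "(\<Sum>s\<in>modes \<beta>. l s * (amp (bst \<beta> s) (a, p) * cnj (amp (bst \<beta> s) (a, p'))))
    = shift_kernel L p p'" if "(a, p) \<in> cells \<beta>" "(a, p') \<in> cells \<beta>" for p p'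
  proof -
    obtain x y x' y' where p: "p = (x, y)" "p' = (x', y')" by (metis surj_pair)
    have m: "x \<in> {b..<b + M}" "x' \<in> {b..<b + M}" "y \<in> {c..<c + N}" "y' \<in> {c..<c + N}"
      using that by (auto simp: \<beta> p)
    show ?thesis
      unfolding shift_kernel_def L_def p
    proof (rule sum.cong [OF refl])
      fix s assume "s \<in> modes \<beta>"
      obtain i j k where s: "s = (i, j, k)" by (cases s)
      have "i = 0" using \<open>s \<in> modes \<beta>\<close> by (simp add: s \<beta>)
      have "amp (bst \<beta> s) (a, x, y) * cnj (amp (bst \<beta> s) (a, x', y'))
        = (fvec b M j x * cnj (fvec b M j x')) * (fvec c N k y * cnj (fvec c N k y'))"
        by (simp add: s \<beta> amp_def tensor3_def \<open>i = 0\<close> fvec_def [of a])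
      then show "l s * (amp (bst \<beta> s) (a, x, y) * cnj (amp (bst \<beta> s) (a, x', y')))
        = (case s of (i, j, k) \<Rightarrow> l (i, j, k) *
          (cis (2 * pi * real j * of_int (int (fst (x, y)) - int (fst (x', y'))) / real M) *
           cis (2 * pi * real k * of_int (int (snd (x, y)) - int (snd (x', y'))) / real N)))"
        using m by (simp only: s fvec_mult_cnj prod.case fst_conv snd_conv)
    qed
  qed
  ultimately show ?thesis
    using l unfolding Let_def by (intro exI [of _ L]) (simp flip: L)
qed

section \<open>Strong nonlocality\<close>

text \<open>All that the nonlocality argument asks of the set. The dimensions are unordered, so the
  condition is stable under cyclic shifts of the parties and one bipartition settles all
  three.\<close>

definition outer_shell :: "nat \<Rightarrow> nat \<Rightarrow> nat \<Rightarrow> (nat \<Rightarrow> nat \<Rightarrow> nat \<Rightarrow> complex) set \<Rightarrow> bool" where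
  "outer_shell d1 d2 d3 S \<longleftrightarrow> 3 \<le> d1 \<and> 3 \<le> d2 \<and> 3 \<le> d3 \<and>
    (\<forall>f. bstates (face_box d1 d2 d3 0 f) \<subseteq> S) \<and> stopper d1 d2 d3 \<in> S"

text \<open>E acts on the second and third party. The condition is chosen so that it passes to the
  adjoint and can be met by an effect of the form 1 \<otimes> E on two parties.\<close>

locale preserving =
  fixes d1 d2 d3 :: nat and S :: "(nat \<Rightarrow> nat \<Rightarrow> nat \<Rightarrow> complex) set"
    and E :: "nat \<times> nat \<Rightarrow> nat \<times> nat \<Rightarrow> complex"
  assumes shell: "outer_shell d1 d2 d3 S"
    and preserve: "\<And>\<psi> \<phi>. \<psi> \<in> S \<Longrightarrow> \<phi> \<in> S \<Longrightarrow> \<psi> \<noteq> \<phi> \<Longrightarrow>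
      (\<Sum>y\<in>{..<d2} \<times> {..<d3}. \<Sum>y'\<in>{..<d2} \<times> {..<d3}. \<Sum>i<d1.
        cnj (amp \<psi> (i, y)) * E y y' * amp \<phi> (i, y')) = 0"
begin

abbreviation M where "M \<equiv> d2 - 1"
abbreviation N where "N \<equiv> d3 - 1"
abbreviation box where "box \<equiv> face_box d1 d2 d3 0"

text \<open>The operator 1 \<otimes> E on cells. Its zeros between different first coordinates let a
  mixed difference isolate entries of E.\<close>

definition W :: "cell \<Rightarrow> cell \<Rightarrow> complex" where
  "W p p' = (if fst p = fst p' then E (snd p) (snd p') else 0)"

lemma ge: "3 \<le> d1" "3 \<le> d2" "3 \<le> d3" "2 \<le> M" "2 \<le> N"
  using shell by (auto simp: outer_shell_def)

lemma ge0: "2 * 0 + 3 \<le> d1" "2 * 0 + 3 \<le> d2" "2 * 0 + 3 \<le> d3"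
  using ge by auto

lemma grid_eq: "grid M N = {..<d2} \<times> {..<d3}"
  using ge by (auto simp: grid_def)

lemma full_eq: "full d1 d2 d3 = {..<d1} \<times> grid M N"
  unfolding full_def grid_eq ..

lemma sum_full: "sum X (full d1 d2 d3) = (\<Sum>i<d1. \<Sum>y\<in>grid M N. X (i, y) :: complex)"
  by (simp add: full_eq sum.cartesian_product case_prod_beta')

lemma box_mem:
  "(x, y, z) \<in> cells (box A1) \<longleftrightarrow> 0 < x \<and> x < d1 \<and> y = 0 \<and> z < N"
  "(x, y, z) \<in> cells (box A2) \<longleftrightarrow> 0 < x \<and> x < d1 \<and> y < M \<and> z = N"
  "(x, y, z) \<in> cells (box A3) \<longleftrightarrow> x = d1 - 1 \<and> 0 < y \<and> y \<le> M \<and> z < N"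
  "(x, y, z) \<in> cells (box B1) \<longleftrightarrow> x < d1 - 1 \<and> y = M \<and> 0 < z \<and> z \<le> N"
  "(x, y, z) \<in> cells (box B2) \<longleftrightarrow> x < d1 - 1 \<and> 0 < y \<and> y \<le> M \<and> z = 0"
  "(x, y, z) \<in> cells (box B3) \<longleftrightarrow> x = 0 \<and> y < M \<and> 0 < z \<and> z \<le> N"
  unfolding face_cells [OF ge0] using ge by auto

lemma box_full: "cells (box f) \<subseteq> full d1 d2 d3"
proof
  fix p assume "p \<in> cells (box f)"
  then show "p \<in> full d1 d2 d3"
    using face_box_layer(1) [OF ge0, of "fst p" "fst (snd p)" "snd (snd p)" f] by (simp add: full_def mem_Times_iff)
qed

lemma W_sum:
  "(\<Sum>p\<in>full d1 d2 d3. \<Sum>p'\<in>full d1 d2 d3. cnj (f p) * W p p' * g p')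
    = (\<Sum>y\<in>grid M N. \<Sum>y'\<in>grid M N. \<Sum>i<d1. cnj (f (i, y)) * E y y' * g (i, y'))"
proof -
  have inner: "(\<Sum>p'\<in>full d1 d2 d3. cnj (f (i, y)) * W (i, y) p' * g p')
    = (\<Sum>y'\<in>grid M N. cnj (f (i, y)) * E y y' * g (i, y'))" if "i < d1" for i y
  proof -
    have "(\<Sum>p'\<in>full d1 d2 d3. cnj (f (i, y)) * W (i, y) p' * g p')
      = (\<Sum>i'<d1. \<Sum>y'\<in>grid M N. cnj (f (i, y)) * W (i, y) (i', y') * g (i', y'))"
      by (rule sum_full)
    also have "\<dots> = (\<Sum>y'\<in>grid M N. \<Sum>i'<d1. if i' = i then cnj (f (i, y)) * E y y' * g (i, y') else 0)"
      by (subst sum.swap) (auto intro!: sum.cong simp: W_def)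
    finally show ?thesis using that by simp
  qed
  have "(\<Sum>p\<in>full d1 d2 d3. \<Sum>p'\<in>full d1 d2 d3. cnj (f p) * W p p' * g p')
    = (\<Sum>i<d1. \<Sum>y\<in>grid M N. \<Sum>p'\<in>full d1 d2 d3. cnj (f (i, y)) * W (i, y) p' * g p')"
    by (rule sum_full)
  also have "\<dots> = (\<Sum>i<d1. \<Sum>y\<in>grid M N. \<Sum>y'\<in>grid M N. cnj (f (i, y)) * E y y' * g (i, y'))"
    by (intro sum.cong refl inner) simp
  also have "\<dots> = (\<Sum>y\<in>grid M N. \<Sum>i<d1. \<Sum>y'\<in>grid M N. cnj (f (i, y)) * E y y' * g (i, y'))"
    by (rule sum.swap)
  also have "\<dots> = (\<Sum>y\<in>grid M N. \<Sum>y'\<in>grid M N. \<Sum>i<d1. cnj (f (i, y)) * E y y' * g (i, y'))"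
    by (intro sum.cong refl sum.swap)
  finally show ?thesis .
qed

lemma W_preserve:
  assumes "\<psi> \<in> S" "\<phi> \<in> S" "\<psi> \<noteq> \<phi>"
  shows "(\<Sum>p\<in>full d1 d2 d3. \<Sum>p'\<in>full d1 d2 d3. cnj (amp \<psi> p) * W p p' * amp \<phi> p') = 0"
  unfolding W_sum grid_eq by (rule preserve [OF assms])

lemma restrict_left:
  "(\<Sum>p\<in>full d1 d2 d3. cnj (amp (bst (box f) s) p) * X p) = (\<Sum>p\<in>cells (box f). cnj (amp (bst (box f) s) p) * X p)"
  using box_full by (intro sum.mono_neutral_right) (auto simp: amp_bst_0)

lemma restrict_right:
  "(\<Sum>p\<in>full d1 d2 d3. X p * amp (bst (box f) s) p) = (\<Sum>p\<in>cells (box f). X p * amp (bst (box f) s) p)"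
  using box_full by (intro sum.mono_neutral_right) (auto simp: amp_bst_0)

lemma box_state: "s \<in> modes (box f) - {(0, 0, 0)} \<Longrightarrow> bst (box f) s \<in> S"
  using shell by (auto simp: outer_shell_def bstates_def)

text \<open>Preservation concerns distinct vectors; \<open>bst_inj\<close> and disjointness of the
  slabs supply that distinctness.\<close>

lemma W_boxes:
  assumes "s \<in> modes (box f) - {(0, 0, 0)}" "s' \<in> modes (box f') - {(0, 0, 0)}" "(f, s) \<noteq> (f', s')"
  shows "(\<Sum>p\<in>cells (box f). \<Sum>p'\<in>cells (box f'). cnj (amp (bst (box f) s) p) * W p p' * amp (bst (box f') s') p') = 0"
proof -
  have ne: "bst (box f) s \<noteq> bst (box f') s'"
  proof
    assume eq: "bst (box f) s = bst (box f') s'"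
    have d: "box f = box f' \<or> cells (box f) \<inter> cells (box f') = {}"
      using face_box_disjoint [OF ge0, of f f'] by auto
    have "box f = box f' \<and> s = s'"
      by (rule bst_inj [OF eq _ _ d]) (use assms in auto)
    moreover have "f = f'"
      using face_box_disjoint [OF ge0, of f f'] modes_cells [of s "box f"] assms(1) calculation by auto
    ultimately show False using assms(3) by simp
  qed
  have "(\<Sum>p\<in>full d1 d2 d3. \<Sum>p'\<in>full d1 d2 d3. cnj (amp (bst (box f) s) p) * W p p' * amp (bst (box f') s') p') = 0"
    by (rule W_preserve [OF box_state [OF assms(1)] box_state [OF assms(2)] ne])
  then show ?thesis
    unfolding restrict_right mult.assoc sum_distrib_left [symmetric] restrict_left .
qed

lemma W_double:
  assumes "f \<noteq> f'" "p \<in> cells (box f)" "q \<in> cells (box f)" "p' \<in> cells (box f')" "q' \<in> cells (box f')"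
  shows "W p p' - W q p' - W p q' + W q q' = 0"
  by (rule bst_double [OF W_boxes assms(2-5)]) (use assms(1) in auto)

text \<open>The four slabs are long in the first direction and share layer 1. When each argument is
  also moved to a second layer of its slab, the mixed difference keeps E y y' once, or twice if both
  move to the same layer.\<close>

lemma tile_zero:
  assumes "f \<in> {A1, A2, B1, B2}" "f' \<in> {A1, A2, B1, B2}" "f \<noteq> f'"
    and y: "(1, y) \<in> cells (box f)" "(1, y') \<in> cells (box f')"
  shows "E y y' = 0"
proof -
  \<comment> \<open>A1 and A2 occupy the layers 1 to d1 - 1, B1 and B2 the layers 0 to d1 - 2; as d1
    \<ge> 3, layer 2 and layer 0 are available.\<close>
  define z where "z f = (if f \<in> {A1, A2} then 2 else 0::nat)" for f
  have z: "(z f, y) \<in> cells (box f)" if "f \<in> {A1, A2, B1, B2}" "(1, y) \<in> cells (box f)" for f y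
    using that ge by (cases y) (auto simp: z_def box_mem simp del: face_box.simps)
  have z1: "z f \<noteq> 1" for f by (simp add: z_def)
  have "W (1, y) (1, y') - W (z f, y) (1, y') - W (1, y) (z f', y') + W (z f, y) (z f', y') = 0"
    by (rule W_double [OF assms(3) y(1) z [OF assms(1) y(1)] y(2) z [OF assms(2) y(2)]])
  from this [unfolded W_def fst_conv snd_conv]
  have "E y y' + (if z f = z f' then E y y' else 0) = 0"
    using z1 [of f] z1 [of f'] by simp
  then show ?thesis by (auto split: if_splits)
qed

text \<open>Only y changes its layer while y' and w stay at i, so both terms at layer z vanish in
  the mixed difference.\<close>

lemma slab_const:
  assumes "f \<noteq> f'" "(i, y) \<in> cells (box f)" "(z, y) \<in> cells (box f)" "i \<noteq> z"
    "(i, y') \<in> cells (box f')" "(i, w) \<in> cells (box f')"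
  shows "E y y' = E y w"
  using W_double [OF assms(1-3,5,6)] assms(4) by (simp add: W_def)

lemma face_tile:
  "(1, w) \<in> cells (box A1) \<longleftrightarrow> w \<in> grid M N \<and> tile M N w = 1"
  "(1, w) \<in> cells (box A2) \<longleftrightarrow> w \<in> grid M N \<and> tile M N w = 2"
  "(1, w) \<in> cells (box B1) \<longleftrightarrow> w \<in> grid M N \<and> tile M N w = 3"
  "(1, w) \<in> cells (box B2) \<longleftrightarrow> w \<in> grid M N \<and> tile M N w = 4"
proof -
  obtain j k where w: "w = (j, k)" by (cases w)
  have d: "1 < d1" "1 < d1 - 1" "0 < M" "0 < N" using ge by auto
  show "(1, w) \<in> cells (box A1) \<longleftrightarrow> w \<in> grid M N \<and> tile M N w = 1"
    "(1, w) \<in> cells (box A2) \<longleftrightarrow> w \<in> grid M N \<and> tile M N w = 2"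
    "(1, w) \<in> cells (box B1) \<longleftrightarrow> w \<in> grid M N \<and> tile M N w = 3"
    "(1, w) \<in> cells (box B2) \<longleftrightarrow> w \<in> grid M N \<and> tile M N w = 4"
    unfolding w box_mem tile_def grid_def prod.case mem_Times_iff fst_conv snd_conv atMost_iff
    using d by (simp_all split: if_split) linarith+
qed

lemma tile_face:
  assumes "y \<in> grid M N" "tile M N y \<noteq> 0"
  obtains f where "f \<in> {A1, A2, B1, B2}" "(1, y) \<in> cells (box f)"
    "\<And>w. (1, w) \<in> cells (box f) \<longleftrightarrow> w \<in> grid M N \<and> tile M N w = tile M N y"
proof -
  have "tile M N y \<in> {1, 2, 3, 4}"
  proof -
    have "tile M N y \<in> {0, 1, 2, 3, 4}" by (cases y) (simp add: tile_def)
    then show ?thesis using assms(2) by blast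
  qed
  then consider "tile M N y = 1" | "tile M N y = 2" | "tile M N y = 3" | "tile M N y = 4"
    by blast
  then show ?thesis
  proof cases
    case 1
    show ?thesis
      by (rule that [of A1]) (simp_all only: face_tile(1) 1 assms(1) insert_iff simp_thms)
  next
    case 2
    show ?thesis
      by (rule that [of A2]) (simp_all only: face_tile(2) 2 assms(1) insert_iff simp_thms)
  next
    case 3
    show ?thesis
      by (rule that [of B1]) (simp_all only: face_tile(3) 3 assms(1) insert_iff simp_thms)
  next
    case 4
    show ?thesis
      by (rule that [of B2]) (simp_all only: face_tile(4) 4 assms(1) insert_iff simp_thms)
  qed
qed

text \<open>An interior y' is in the projection of no long slab. But the slab of y reaches the layer
  of A3 or of B3, along which the row E y is constant, and y' can be moved there to a grid corner in
  a foreign tile. An interior first argument is left to the adjoint.\<close>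

lemma tiles_half:
  assumes y: "y \<in> grid M N" "y' \<in> grid M N" and ne: "tile M N y \<noteq> tile M N y'" and "tile M N y \<noteq> 0"
  shows "E y y' = 0"
proof -
  obtain f where f: "f \<in> {A1, A2, B1, B2}" "(1, y) \<in> cells (box f)"
    "\<And>w. (1, w) \<in> cells (box f) \<longleftrightarrow> w \<in> grid M N \<and> tile M N w = tile M N y"
    using tile_face [OF y(1) assms(4)] by blast
  show ?thesis
  proof (cases "tile M N y' = 0")
    case False
    obtain f' where f': "f' \<in> {A1, A2, B1, B2}" "(1, y') \<in> cells (box f')"
      "\<And>w. (1, w) \<in> cells (box f') \<longleftrightarrow> w \<in> grid M N \<and> tile M N w = tile M N y'"
      using tile_face [OF y(2) False] by blast
    have "f \<noteq> f'" using f(3) [of y] f'(3) [of y] y ne by auto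
    then show ?thesis using tile_zero f(1,2) f'(1,2) by blast
  next
    case True
    obtain j k where jk: "y' = (j, k)" by (cases y')
    have in': "0 < j" "j < M" "0 < k" "k < N"
      using True y(2) ge by (auto simp: jk tile_def grid_def split: if_splits)
    consider "f = A1 \<or> f = A2" | "f = B1 \<or> f = B2" using f(1) by blast
    then show ?thesis
    proof cases
      case 1
      \<comment> \<open>The corner (M, 0) lies in the projection of A3 and in the tile of B2; in the
        other case (0, N) lies in that of B3 and in the tile of A2.\<close>
      have "E y y' = E y (M, 0)"
      proof (rule slab_const [of f A3 "d1 - 1" y 1])
        show "(d1 - 1, y) \<in> cells (box f)"
          using 1 f(2) ge by (cases y) (auto simp: box_mem simp del: face_box.simps)
        show "f \<noteq> A3" using 1 by auto
        show "(d1 - 1, y') \<in> cells (box A3)" unfolding jk box_mem using in' by simp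
        show "(d1 - 1, (M, 0)) \<in> cells (box A3)" unfolding box_mem using ge by simp
      qed (use f(2) ge in simp_all)
      also have "\<dots> = 0"
      proof (rule tile_zero [of f B2])
        show "(1, (M, 0)) \<in> cells (box B2)" unfolding box_mem using ge by simp
      qed (use 1 f(1,2) in auto)
      finally show ?thesis .
    next
      case 2
      have "E y y' = E y (0, N)"
      proof (rule slab_const [of f B3 0 y 1])
        show "(0, y) \<in> cells (box f)"
          using 2 f(2) ge by (cases y) (auto simp: box_mem simp del: face_box.simps)
        show "f \<noteq> B3" using 2 by auto
        show "(0, y') \<in> cells (box B3)" unfolding jk box_mem using in' by simp
        show "(0, (0, N)) \<in> cells (box B3)" unfolding box_mem using ge by simp
      qed (use f(2) in simp_all)
      also have "\<dots> = 0"
      proof (rule tile_zero [of f A2])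
        show "(1, (0, N)) \<in> cells (box A2)" unfolding box_mem using ge by simp
      qed (use 2 f(1,2) in auto)
      finally show ?thesis .
    qed
  qed
qed

text \<open>Applied to the stopper, 1 \<otimes> E yields the row sums of E. Orthogonality to the
  nontrivial modes of a slab makes them constant on it.\<close>

lemma row_const:
  assumes "(i, y) \<in> cells (box f)" "(i', y') \<in> cells (box f)"
  shows "sum (E y) (grid M N) = sum (E y') (grid M N)"
proof -
  define \<phi> where "\<phi> p = sum (E (snd p)) (grid M N)" for p :: cell
  have "\<phi> (i, y) = \<phi> (i', y')"
  proof (rule bst_const_cnj [OF _ assms])
    fix s assume s: "s \<in> modes (box f)" "s \<noteq> (0, 0, 0)"
    have st: "stopper d1 d2 d3 \<in> S" using shell by (simp add: outer_shell_def)
    have "bst (box f) s \<noteq> stopper d1 d2 d3"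
    proof
      assume eq: "bst (box f) s = stopper d1 d2 d3"
      show False
        using inner3_bst_stopper [OF box_full s] inner3_bst_self [OF box_full s(1)] by (simp add: eq)
    qed
    then have "(\<Sum>p\<in>full d1 d2 d3. \<Sum>p'\<in>full d1 d2 d3. cnj (amp (bst (box f) s) p) * W p p' * amp (stopper d1 d2 d3) p') = 0"
      using W_preserve [OF box_state st] s by simp
    then have "(\<Sum>p\<in>full d1 d2 d3. cnj (amp (bst (box f) s) p) * (\<Sum>p'\<in>full d1 d2 d3. W p p')) = 0"
      by (simp add: amp_stopper sum_distrib_left)
    then have "(\<Sum>p\<in>cells (box f). cnj (amp (bst (box f) s) p) * (\<Sum>p'\<in>full d1 d2 d3. W p p')) = 0"
      unfolding restrict_left .
    moreover have "(\<Sum>p'\<in>full d1 d2 d3. W p p') = \<phi> p" if "p \<in> cells (box f)" for p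
    proof -
      have "p \<in> full d1 d2 d3" using that box_full by blast
      then have p: "fst p < d1" by (auto simp: full_def)
      have "(\<Sum>p'\<in>full d1 d2 d3. W p p') = (\<Sum>y'\<in>grid M N. \<Sum>i'<d1. if i' = fst p then E (snd p) y' else 0)"
        unfolding sum_full
        by (subst sum.swap) (auto intro!: sum.cong simp: W_def)
      then show ?thesis using p by (simp add: \<phi>_def)
    qed
    ultimately show "(\<Sum>p\<in>cells (box f). cnj (amp (bst (box f) s) p) * \<phi> p) = 0" by simp
  qed
  then show ?thesis by (simp add: \<phi>_def)
qed

lemma conv_face:
  assumes "box f = ((a, 1), (b, M), (c, N))"
  shows "\<exists>L. (\<forall>x y. L (x mod int M) (y mod int N) = L x y) \<and>
    (\<forall>p q p' q'. (a, p) \<in> cells (box f) \<longrightarrow> (a, q) \<in> cells (box f) \<longrightarrow> (a, p') \<in> cells (box f) \<longrightarrow> (a, q') \<in> cells (box f) \<longrightarrow>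
      E p p' - E q p' - E p q' + E q q'
      = shift_kernel L p p' - shift_kernel L q p' - shift_kernel L p q' + shift_kernel L q q')"
proof -
  have "0 < M" "0 < N" using ge by auto
  from bst_shift_kernel [OF assms this, of W] W_boxes [of _ f _ f]
  show ?thesis unfolding W_def by simp
qed

lemma conv_low: "\<exists>L. (\<forall>a b. L (a mod int M) (b mod int N) = L a b) \<and>
      (\<forall>p\<in>low M N. \<forall>q\<in>low M N. \<forall>p'\<in>low M N. \<forall>q'\<in>low M N. E p p' - E q p' - E p q' + E q q'
        = shift_kernel L p p' - shift_kernel L q p' - shift_kernel L p q' + shift_kernel L q q')"
proof -
  have *: "(0, p) \<in> cells (box B3)" if "p \<in> low M N" for p
    using that by (cases p) (auto simp: low_def box_mem simp del: face_box.simps)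
  have "box B3 = ((0, 1), (0, M), (1, N))" by simp
  from conv_face [OF this] obtain L where L: "\<forall>a b. L (a mod int M) (b mod int N) = L a b"
    "\<And>p q p' q'. (0, p) \<in> cells (box B3) \<Longrightarrow> (0, q) \<in> cells (box B3) \<Longrightarrow> (0, p') \<in> cells (box B3) \<Longrightarrow>
      (0, q') \<in> cells (box B3) \<Longrightarrow> E p p' - E q p' - E p q' + E q q'
      = shift_kernel L p p' - shift_kernel L q p' - shift_kernel L p q' + shift_kernel L q q'"
    by (elim exE conjE) simp
  show ?thesis
    by (intro exI [of _ L] conjI ballI L * | assumption)+
qed

lemma conv_high: "\<exists>L. (\<forall>a b. L (a mod int M) (b mod int N) = L a b) \<and>
      (\<forall>p\<in>high M N. \<forall>q\<in>high M N. \<forall>p'\<in>high M N. \<forall>q'\<in>high M N. E p p' - E q p' - E p q' + E q q'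
        = shift_kernel L p p' - shift_kernel L q p' - shift_kernel L p q' + shift_kernel L q q')"
proof -
  have *: "(d1 - 1, p) \<in> cells (box A3)" if "p \<in> high M N" for p
    using that by (cases p) (auto simp: high_def box_mem simp del: face_box.simps)
  have "box A3 = ((d1 - 1, 1), (1, M), (0, N))" by simp
  from conv_face [OF this] obtain L where L: "\<forall>a b. L (a mod int M) (b mod int N) = L a b"
    "\<And>p q p' q'. (d1 - 1, p) \<in> cells (box A3) \<Longrightarrow> (d1 - 1, q) \<in> cells (box A3) \<Longrightarrow> (d1 - 1, p') \<in> cells (box A3) \<Longrightarrow>
      (d1 - 1, q') \<in> cells (box A3) \<Longrightarrow> E p p' - E q p' - E p q' + E q q'
      = shift_kernel L p p' - shift_kernel L q p' - shift_kernel L p q' + shift_kernel L q q'"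
    by (elim exE conjE) simp
  show ?thesis
    by (intro exI [of _ L] conjI ballI L * | assumption)+
qed

end

text \<open>Column sums, and entries whose first argument is interior, become row statements about
  the adjoint.\<close>

lemma preserving_adjoint:
  assumes "preserving d1 d2 d3 S E"
  shows "preserving d1 d2 d3 S (\<lambda>y y'. cnj (E y' y))"
proof
  interpret preserving d1 d2 d3 S E by (rule assms)
  show "outer_shell d1 d2 d3 S" by (rule shell)
  fix \<psi> \<phi> assume "\<psi> \<in> S" "\<phi> \<in> S" "\<psi> \<noteq> \<phi>"
  let ?J = "{..<d2} \<times> {..<d3}"
  have "(\<Sum>y\<in>?J. \<Sum>y'\<in>?J. \<Sum>i<d1. cnj (amp \<psi> (i, y)) * cnj (E y' y) * amp \<phi> (i, y'))
    = cnj (\<Sum>y\<in>?J. \<Sum>y'\<in>?J. \<Sum>i<d1. cnj (amp \<phi> (i, y')) * E y' y * amp \<psi> (i, y))"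
    by (simp add: mult_ac)
  also have "(\<Sum>y\<in>?J. \<Sum>y'\<in>?J. \<Sum>i<d1. cnj (amp \<phi> (i, y')) * E y' y * amp \<psi> (i, y)) = 0"
    by (subst sum.swap) (use preserve [of \<phi> \<psi>] \<open>\<psi> \<in> S\<close> \<open>\<phi> \<in> S\<close> \<open>\<psi> \<noteq> \<phi>\<close> in simp)
  finally show "(\<Sum>y\<in>?J. \<Sum>y'\<in>?J. \<Sum>i<d1. cnj (amp \<psi> (i, y)) * cnj (E y' y) * amp \<phi> (i, y')) = 0" by simp
qed

lemma preserving_scalar:
  assumes "preserving d1 d2 d3 S E"
  shows "\<exists>h. \<forall>y\<in>{..<d2} \<times> {..<d3}. \<forall>y'\<in>{..<d2} \<times> {..<d3}. E y y' = (if y = y' then h else 0)"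
proof -
  interpret preserving d1 d2 d3 S E by (rule assms)
  interpret adj: preserving d1 d2 d3 S "\<lambda>y y'. cnj (E y' y)" by (rule preserving_adjoint [OF assms])
  have lowB: "(0, y) \<in> cells (box B3)" if "y \<in> low M N" for y
    using that by (cases y) (auto simp: low_def box_mem simp del: face_box.simps)
  have highA: "(d1 - 1, y) \<in> cells (box A3)" if "y \<in> high M N" for y
    using that by (cases y) (auto simp: high_def box_mem simp del: face_box.simps)
  have col_const: "(\<Sum>w\<in>grid M N. E w y) = (\<Sum>w\<in>grid M N. E w y')"
    if "(i, y) \<in> cells (box f)" "(i, y') \<in> cells (box f)" for i y y' f
    using arg_cong [OF adj.row_const [OF that], of cnj] by simp
  have "\<exists>h. \<forall>y\<in>grid M N. \<forall>y'\<in>grid M N. E y y' = (if y = y' then h else 0)"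
  proof (rule kernel_scalar [OF ge(4,5)])
    show "E y y' = 0" if "y \<in> grid M N" "y' \<in> grid M N" "tile M N y \<noteq> tile M N y'" for y y'
    proof (cases "tile M N y = 0")
      case True
      then have "cnj (E y y') = 0" using adj.tiles_half [OF that(2,1)] that(3) by simp
      then show ?thesis by simp
    next
      case False
      then show ?thesis by (rule tiles_half [OF that])
    qed
    show "sum (E y) (grid M N) = sum (E y') (grid M N)" if "y \<in> low M N" "y' \<in> low M N" for y y'
      by (rule row_const [OF lowB lowB]) (fact that)+
    show "sum (E y) (grid M N) = sum (E y') (grid M N)" if "y \<in> high M N" "y' \<in> high M N" for y y'
      by (rule row_const [OF highA highA]) (fact that)+
    \<comment> \<open>The slabs A1 and B1 tie the corners (0, 0) and (M, N) to neighbours in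
      \<open>low\<close> and \<open>high\<close>.\<close>
    show "sum (E (0, 0)) (grid M N) = sum (E (0, 1)) (grid M N)"
      by (rule row_const [of 1 _ A1 1]) (use ge in \<open>auto simp: box_mem simp del: face_box.simps\<close>)
    show "sum (E (M, N)) (grid M N) = sum (E (M, N - 1)) (grid M N)"
      by (rule row_const [of 0 _ B1 0]) (use ge in \<open>auto simp: box_mem simp del: face_box.simps\<close>)
    show "(\<Sum>w\<in>grid M N. E w y) = (\<Sum>w\<in>grid M N. E w y')" if "y \<in> low M N" "y' \<in> low M N" for y y'
      by (rule col_const [OF lowB lowB]) (fact that)+
    show "(\<Sum>w\<in>grid M N. E w y) = (\<Sum>w\<in>grid M N. E w y')" if "y \<in> high M N" "y' \<in> high M N" for y y'
      by (rule col_const [OF highA highA]) (fact that)+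
  qed (rule conv_low conv_high)+
  then show ?thesis unfolding grid_eq .
qed

section \<open>Cyclic permutation of the parties\<close>

definition rotate_parties :: "(nat \<Rightarrow> nat \<Rightarrow> nat \<Rightarrow> complex) \<Rightarrow> nat \<Rightarrow> nat \<Rightarrow> nat \<Rightarrow> complex" where
  "rotate_parties \<psi> = (\<lambda>j k i. \<psi> i j k)"

lemma rotate_bst: "rotate_parties (bst (\<alpha>, \<beta>, \<gamma>) (i, j, k)) = bst (\<beta>, \<gamma>, \<alpha>) (j, k, i)"
  by (cases \<alpha>; cases \<beta>; cases \<gamma>) (auto simp: rotate_parties_def tensor3_def fun_eq_iff)

lemma rotate_bstates: "bstates (\<beta>, \<gamma>, \<alpha>) = rotate_parties ` bstates (\<alpha>, \<beta>, \<gamma>)"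
proof -
  have m: "modes (\<beta>, \<gamma>, \<alpha>) - {(0, 0, 0)} = (\<lambda>(i, j, k). (j, k, i)) ` (modes (\<alpha>, \<beta>, \<gamma>) - {(0, 0, 0)})"
  proof (intro set_eqI iffI)
    fix s assume s: "s \<in> modes (\<beta>, \<gamma>, \<alpha>) - {(0, 0, 0)}"
    obtain j k i where jki: "s = (j, k, i)" by (cases s)
    have "(i, j, k) \<in> modes (\<alpha>, \<beta>, \<gamma>) - {(0, 0, 0)}"
      using s by (cases \<alpha>; cases \<beta>; cases \<gamma>) (auto simp: jki)
    then show "s \<in> (\<lambda>(i, j, k). (j, k, i)) ` (modes (\<alpha>, \<beta>, \<gamma>) - {(0, 0, 0)})"
      by (rule rev_image_eqI) (simp add: jki)
  qed (cases \<alpha>; cases \<beta>; cases \<gamma>; auto)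
  show ?thesis
    unfolding bstates_def m image_image
    by (rule image_cong) (auto simp: rotate_bst)
qed

lemma outer_shell_rotate:
  assumes "outer_shell d1 d2 d3 S"
  shows "outer_shell d2 d3 d1 (rotate_parties ` S)"
proof -
  have "bstates (face_box d2 d3 d1 0 f) \<subseteq> rotate_parties ` S" for f
  proof -
    \<comment> \<open>The slab that the rotation turns into f, along the two orbits of
      slabs.\<close>
    define g where "g = (case f of A1 \<Rightarrow> B2 | B2 \<Rightarrow> B3 | B3 \<Rightarrow> A1 | A2 \<Rightarrow> A3 | A3 \<Rightarrow> B1 | B1 \<Rightarrow> A2)"
    have "bstates (face_box d2 d3 d1 0 f) = rotate_parties ` bstates (face_box d1 d2 d3 0 g)"
      by (cases f) (simp_all only: g_def face.case face_box.simps rotate_bstates [symmetric])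
    then show ?thesis using assms by (auto simp: outer_shell_def)
  qed
  moreover have "stopper d2 d3 d1 = rotate_parties (stopper d1 d2 d3)"
    by (simp only: stopper_bst rotate_bst)
  ultimately show ?thesis using assms by (auto simp: outer_shell_def)
qed

lemma inner3_rotate: "inner3 d2 d3 d1 (rotate_parties \<psi>) (rotate_parties \<phi>) = inner3 d1 d2 d3 \<psi> \<phi>"
proof -
  have "inner3 d2 d3 d1 (rotate_parties \<psi>) (rotate_parties \<phi>) = (\<Sum>j<d2. \<Sum>k<d3. \<Sum>i<d1. cnj (\<psi> i j k) * \<phi> i j k)"
    by (simp add: inner3_def rotate_parties_def)
  also have "\<dots> = (\<Sum>j<d2. \<Sum>i<d1. \<Sum>k<d3. cnj (\<psi> i j k) * \<phi> i j k)"
    by (intro sum.cong refl sum.swap)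
  also have "\<dots> = inner3 d1 d2 d3 \<psi> \<phi>"
    unfolding inner3_def by (rule sum.swap)
  finally show ?thesis .
qed

section \<open>Irreducibility across a bipartition\<close>

lemma elem_left_scalar:
  assumes "finite I" "finite J" and "\<And>x x'. x \<in> I \<Longrightarrow> x' \<in> I \<Longrightarrow> E x x' = (if x = x' then h else 0)"
  shows "elem_left I J E \<psi> \<psi> = h * (\<Sum>x\<in>I. \<Sum>y\<in>J. cnj (\<psi> x y) * \<psi> x y)"
proof -
  have "elem_left I J E \<psi> \<psi> = (\<Sum>x\<in>I. \<Sum>x'\<in>I. if x' = x then h * (\<Sum>y\<in>J. cnj (\<psi> x y) * \<psi> x y) else 0)"
    unfolding elem_left_def using assms(3)
    by (intro sum.cong refl) (auto simp: sum_distrib_left mult_ac)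
  then show ?thesis using assms by (simp add: sum_distrib_left)
qed

text \<open>A scalar effect multiplies all squared norms by the same factor, so it eliminates nothing.\<close>

lemma irreducible_leftI:
  assumes fin: "finite I" "finite J"
    and nz: "\<And>\<psi>. \<psi> \<in> S \<Longrightarrow> (\<Sum>x\<in>I. \<Sum>y\<in>J. cnj (\<psi> x y) * \<psi> x y) \<noteq> 0"
    and scalar: "\<And>E. (\<And>\<psi> \<phi>. \<psi> \<in> S \<Longrightarrow> \<phi> \<in> S \<Longrightarrow> \<psi> \<noteq> \<phi> \<Longrightarrow> elem_left I J E \<psi> \<phi> = 0) \<Longrightarrow>
      \<exists>h. \<forall>x\<in>I. \<forall>x'\<in>I. E x x' = (if x = x' then h else 0)"
  shows "irreducible_left I J S"
  unfolding irreducible_left_def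
proof (intro allI impI)
  fix Ms :: "nat set" and E assume op: "OP_meas_left I J S Ms E"
  show "\<not> eliminates_left I J S Ms E"
  proof
    assume "eliminates_left I J S Ms E"
    then obtain m \<psi> \<phi> where m: "m \<in> Ms" "\<psi> \<in> S" "\<phi> \<in> S" "elem_left I J (E m) \<psi> \<psi> = 0"
      "elem_left I J (E m) \<phi> \<phi> \<noteq> 0"
      unfolding eliminates_left_def by blast
    obtain h where "\<And>x x'. x \<in> I \<Longrightarrow> x' \<in> I \<Longrightarrow> E m x x' = (if x = x' then h else 0)"
      using scalar [of "E m"] op m(1) unfolding OP_meas_left_def by blast
    note e = elem_left_scalar [OF fin this]
    from m(4) nz [OF m(2)] have "h = 0" by (simp add: e)
    then show False using m(5) by (simp add: e)
  qed
qed

lemma sum_pairs: "sum X (A \<times> B) = (\<Sum>a\<in>A. \<Sum>b\<in>B. X (a, b) :: complex)"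
  by (simp add: sum.cartesian_product case_prod_beta')

lemma sum_delta_nested:
  assumes "finite A" "k \<in> A"
  shows "(\<Sum>k'\<in>A. \<Sum>i\<in>B. \<Sum>j\<in>C. if k' = k then X i j else 0) = (\<Sum>i\<in>B. \<Sum>j\<in>C. X i j :: complex)"
proof -
  have "(\<Sum>k'\<in>A. \<Sum>i\<in>B. \<Sum>j\<in>C. if k' = k then X i j else 0)
    = (\<Sum>k'\<in>A. if k' = k then \<Sum>i\<in>B. \<Sum>j\<in>C. X i j else 0)"
    by (rule sum.cong) auto
  then show ?thesis using assms by simp
qed

lemma irreducible_pair:
  assumes shell: "outer_shell d1 d2 d3 S" and nz: "\<And>\<psi>. \<psi> \<in> S \<Longrightarrow> inner3 d1 d2 d3 \<psi> \<psi> \<noteq> 0"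
  shows "irreducible_left ({..<d2} \<times> {..<d3}) {..<d1} ((\<lambda>\<psi> (j, k) i. \<psi> i j k) ` S)"
proof (rule irreducible_leftI)
  let ?J = "{..<d2} \<times> {..<d3}" and ?r = "\<lambda>\<psi>::nat \<Rightarrow> nat \<Rightarrow> nat \<Rightarrow> complex. \<lambda>(j, k) i. \<psi> i j k"
  have r: "?r \<psi> y i = amp \<psi> (i, y)" for \<psi> y i by (cases y) (simp add: amp_def)
  fix \<Psi> assume "\<Psi> \<in> ?r ` S"
  then obtain \<psi> where \<psi>: "\<psi> \<in> S" "\<Psi> = ?r \<psi>" by blast
  have "(\<Sum>x\<in>?J. \<Sum>y<d1. cnj (\<Psi> x y) * \<Psi> x y) = (\<Sum>y<d1. \<Sum>x\<in>?J. cnj (amp \<psi> (y, x)) * amp \<psi> (y, x))"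
    unfolding \<psi>(2) r by (rule sum.swap)
  also have "\<dots> = inner3 d1 d2 d3 \<psi> \<psi>"
    unfolding inner3_amp full_def by (simp add: sum.cartesian_product case_prod_beta')
  finally show "(\<Sum>x\<in>?J. \<Sum>y<d1. cnj (\<Psi> x y) * \<Psi> x y) \<noteq> 0" using nz [OF \<psi>(1)] by simp
next
  let ?J = "{..<d2} \<times> {..<d3}" and ?r = "\<lambda>\<psi>::nat \<Rightarrow> nat \<Rightarrow> nat \<Rightarrow> complex. \<lambda>(j, k) i. \<psi> i j k"
  have r: "?r \<psi> y i = amp \<psi> (i, y)" for \<psi> y i by (cases y) (simp add: amp_def)
  fix E assume E: "\<And>\<psi> \<phi>. \<psi> \<in> ?r ` S \<Longrightarrow> \<phi> \<in> ?r ` S \<Longrightarrow> \<psi> \<noteq> \<phi> \<Longrightarrow> elem_left ?J {..<d1} E \<psi> \<phi> = 0"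
  have "preserving d1 d2 d3 S E"
  proof
    fix \<psi> \<phi> assume S: "\<psi> \<in> S" "\<phi> \<in> S" and ne: "\<psi> \<noteq> \<phi>"
    have "?r \<psi> \<noteq> ?r \<phi>"
    proof
      assume eq: "?r \<psi> = ?r \<phi>"
      have "\<psi> i j k = \<phi> i j k" for i j k using fun_cong [OF fun_cong [OF eq, of "(j, k)"], of i] by simp
      then have "\<psi> = \<phi>" by (intro ext)
      then show False using ne by simp
    qed
    from E [OF imageI [OF S(1)] imageI [OF S(2)] this]
    show "(\<Sum>y\<in>?J. \<Sum>y'\<in>?J. \<Sum>i<d1. cnj (amp \<psi> (i, y)) * E y y' * amp \<phi> (i, y')) = 0"
      unfolding elem_left_def r .
  qed (rule shell)
  then show "\<exists>h. \<forall>x\<in>?J. \<forall>x'\<in>?J. E x x' = (if x = x' then h else 0)"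
    by (rule preserving_scalar)
qed simp_all

text \<open>An effect E on the first party is treated as the effect 1 \<otimes> E on the third and first party.\<close>

lemma irreducible_single:
  assumes shell: "outer_shell d1 d2 d3 S" and nz: "\<And>\<psi>. \<psi> \<in> S \<Longrightarrow> inner3 d1 d2 d3 \<psi> \<psi> \<noteq> 0"
  shows "irreducible_left {..<d1} ({..<d2} \<times> {..<d3}) ((\<lambda>\<psi> i (j, k). \<psi> i j k) ` S)"
proof (rule irreducible_leftI)
  let ?J = "{..<d2} \<times> {..<d3}" and ?r = "\<lambda>\<psi>::nat \<Rightarrow> nat \<Rightarrow> nat \<Rightarrow> complex. \<lambda>i (j, k). \<psi> i j k"
  have r: "?r \<psi> i y = amp \<psi> (i, y)" for \<psi> y i by (cases y) (simp add: amp_def)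
  fix \<Psi> assume "\<Psi> \<in> ?r ` S"
  then obtain \<psi> where \<psi>: "\<psi> \<in> S" "\<Psi> = ?r \<psi>" by blast
  have "(\<Sum>x<d1. \<Sum>y\<in>?J. cnj (\<Psi> x y) * \<Psi> x y) = inner3 d1 d2 d3 \<psi> \<psi>"
    unfolding inner3_amp full_def \<psi>(2) r by (simp add: sum.cartesian_product case_prod_beta')
  then show "(\<Sum>x<d1. \<Sum>y\<in>?J. cnj (\<Psi> x y) * \<Psi> x y) \<noteq> 0" using nz [OF \<psi>(1)] by simp
next
  let ?J = "{..<d2} \<times> {..<d3}" and ?r = "\<lambda>\<psi>::nat \<Rightarrow> nat \<Rightarrow> nat \<Rightarrow> complex. \<lambda>i (j, k). \<psi> i j k"
  fix E assume E: "\<And>\<psi> \<phi>. \<psi> \<in> ?r ` S \<Longrightarrow> \<phi> \<in> ?r ` S \<Longrightarrow> \<psi> \<noteq> \<phi> \<Longrightarrow> elem_left {..<d1} ?J E \<psi> \<phi> = 0"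
  \<comment> \<open>After rotation the parties come in the order second, third, first, so 1
    \<otimes> E acts on index pairs (k, i); fixing k = 0 recovers E at the end.\<close>
  define F where "F = (\<lambda>(k::nat, i) (k', i'). if k = k' then E i i' else 0)"
  have "preserving d2 d3 d1 (rotate_parties ` S) F"
  proof
    fix \<psi>' \<phi>' assume "\<psi>' \<in> rotate_parties ` S" "\<phi>' \<in> rotate_parties ` S" and ne: "\<psi>' \<noteq> \<phi>'"
    then obtain \<psi> \<phi> where S: "\<psi> \<in> S" "\<phi> \<in> S" "\<psi>' = rotate_parties \<psi>" "\<phi>' = rotate_parties \<phi>" by blast
    have "?r \<psi> \<noteq> ?r \<phi>"
    proof
      assume eq: "?r \<psi> = ?r \<phi>"
      have "\<psi> i j k = \<phi> i j k" for i j k using fun_cong [OF fun_cong [OF eq, of i], of "(j, k)"] by simp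
      then have "\<psi> = \<phi>" by (intro ext)
      then show False using ne S by simp
    qed
    from E [OF imageI [OF S(1)] imageI [OF S(2)] this]
    have z: "(\<Sum>i<d1. \<Sum>i'<d1. \<Sum>j<d2. \<Sum>k<d3. cnj (\<psi> i j k) * E i i' * \<phi> i' j k) = 0"
      unfolding elem_left_def by (simp add: sum.cartesian_product case_prod_beta')
    have "(\<Sum>y\<in>{..<d3} \<times> {..<d1}. \<Sum>y'\<in>{..<d3} \<times> {..<d1}. \<Sum>j<d2. cnj (amp \<psi>' (j, y)) * F y y' * amp \<phi>' (j, y'))
      = (\<Sum>k<d3. \<Sum>i<d1. \<Sum>k'<d3. \<Sum>i'<d1. \<Sum>j<d2. if k' = k then cnj (\<psi> i j k) * E i i' * \<phi> i' j k else 0)"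
      unfolding sum_pairs by (intro sum.cong refl) (auto simp: F_def S amp_def rotate_parties_def)
    also have "\<dots> = (\<Sum>k<d3. \<Sum>i<d1. \<Sum>i'<d1. \<Sum>j<d2. cnj (\<psi> i j k) * E i i' * \<phi> i' j k)"
      by (rule sum.cong [OF refl], rule sum.cong [OF refl], rule sum_delta_nested) simp_all
    also have "\<dots> = (\<Sum>i<d1. \<Sum>k<d3. \<Sum>i'<d1. \<Sum>j<d2. cnj (\<psi> i j k) * E i i' * \<phi> i' j k)"
      by (rule sum.swap)
    also have "\<dots> = (\<Sum>i<d1. \<Sum>i'<d1. \<Sum>k<d3. \<Sum>j<d2. cnj (\<psi> i j k) * E i i' * \<phi> i' j k)"
      by (intro sum.cong refl sum.swap)
    also have "\<dots> = (\<Sum>i<d1. \<Sum>i'<d1. \<Sum>j<d2. \<Sum>k<d3. cnj (\<psi> i j k) * E i i' * \<phi> i' j k)"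
      by (intro sum.cong refl sum.swap)
    finally show "(\<Sum>y\<in>{..<d3} \<times> {..<d1}. \<Sum>y'\<in>{..<d3} \<times> {..<d1}. \<Sum>j<d2. cnj (amp \<psi>' (j, y)) * F y y' * amp \<phi>' (j, y')) = 0"
      by (simp add: z)
  qed (rule outer_shell_rotate [OF shell])
  from preserving_scalar [OF this] obtain h where h: "\<And>y y'. y \<in> {..<d3} \<times> {..<d1} \<Longrightarrow> y' \<in> {..<d3} \<times> {..<d1} \<Longrightarrow>
      F y y' = (if y = y' then h else 0)" by blast
  have "E x x' = (if x = x' then h else 0)" if "x < d1" "x' < d1" for x x'
    using h [of "(0, x)" "(0, x')"] that shell by (simp add: F_def outer_shell_def)
  then show "\<exists>h. \<forall>x\<in>{..<d1}. \<forall>x'\<in>{..<d1}. E x x' = (if x = x' then h else 0)" by blast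
qed simp_all

lemma locally_irreducible_shell:
  assumes "outer_shell d1 d2 d3 S" and "\<And>\<psi>. \<psi> \<in> S \<Longrightarrow> inner3 d1 d2 d3 \<psi> \<psi> \<noteq> 0"
  shows "locally_irreducible {..<d1} ({..<d2} \<times> {..<d3}) ((\<lambda>\<psi> i (j, k). \<psi> i j k) ` S)"
proof -
  have "(\<lambda>\<psi> y x. \<psi> x y) ` (\<lambda>\<psi> i (j, k). \<psi> i j k) ` S = (\<lambda>\<psi> (j, k) i. \<psi> i j k) ` S"
    unfolding image_image by (rule image_cong) (auto simp: fun_eq_iff)
  then show ?thesis
    unfolding locally_irreducible_def
    using irreducible_single [OF assms] irreducible_pair [OF assms] by simp
qed

lemma strongly_nonlocal_shell:
  assumes shell: "outer_shell dA dB dC S" and nz: "\<And>\<psi>. \<psi> \<in> S \<Longrightarrow> inner3 dA dB dC \<psi> \<psi> \<noteq> 0"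
    and orth: "mutually_orthogonal3 dA dB dC S"
  shows "strongly_nonlocal dA dB dC S"
proof -
  have s1: "outer_shell dB dC dA (rotate_parties ` S)" by (rule outer_shell_rotate [OF shell])
  have n1: "inner3 dB dC dA \<psi> \<psi> \<noteq> 0" if "\<psi> \<in> rotate_parties ` S" for \<psi>
    using that nz by (auto simp: inner3_rotate)
  have s2: "outer_shell dC dA dB (rotate_parties ` rotate_parties ` S)" by (rule outer_shell_rotate [OF s1])
  have n2: "inner3 dC dA dB \<psi> \<psi> \<noteq> 0" if "\<psi> \<in> rotate_parties ` rotate_parties ` S" for \<psi>
  proof -
    from that obtain \<phi> where "\<phi> \<in> rotate_parties ` S" "\<psi> = rotate_parties \<phi>" by blast
    then show ?thesis using n1 [of \<phi>] by (simp add: inner3_rotate)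
  qed
  show ?thesis
    unfolding strongly_nonlocal_def
    using orth locally_irreducible_shell [OF shell nz] locally_irreducible_shell [OF s1 n1]
      locally_irreducible_shell [OF s2 n2]
    by (simp add: image_image rotate_parties_def)
qed

lemma setU_outer_shell:
  assumes "2 * n + 3 \<le> dA" "2 * n + 3 \<le> dB" "2 * n + 3 \<le> dC"
  shows "outer_shell dA dB dC (setU dA dB dC n)"
proof -
  have "bstates (face_box dA dB dC 0 f) \<subseteq> setU dA dB dC n" for f
    unfolding setU_blocks [OF assms] by (auto simp: labels_def)
  then show ?thesis using assms by (simp add: outer_shell_def setU_def)
qed

theorem theorem1:
  fixes dA dB dC n :: nat
  assumes "3 \<le> dA" and "dA \<le> dB" and "dB \<le> dC"
    and "n \<le> (dA - 3) div 2"
  shows "UPB dA dB dC (setU dA dB dC n) \<and>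
         strongly_nonlocal dA dB dC (setU dA dB dC n) \<and>
         card (setU dA dB dC n) = dA * dB * dC - 8 * (n + 1)"
proof (intro conjI)
  \<comment> \<open>The bound on n says that the core keeps a positive side length in every
    party.\<close>
  have d: "2 * n + 3 \<le> dA" "2 * n + 3 \<le> dB" "2 * n + 3 \<le> dC"
    using assms by linarith+
  show "UPB dA dB dC (setU dA dB dC n)"
    unfolding UPB_def
  proof (intro conjI ballI)
    fix \<psi> assume \<psi>: "\<psi> \<in> setU dA dB dC n"
    show "is_product3 dA dB dC \<psi>" by (rule setU_product [OF \<psi> d])
    show "\<psi> \<noteq> (\<lambda>i j k. 0)"
      using setU_inner_self [OF d \<psi>] by (auto simp: inner3_def)
  next
    show "\<not> (\<exists>v. is_product3 dA dB dC v \<and> v \<noteq> (\<lambda>i j k. 0) \<and>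
      (\<forall>\<psi>\<in>setU dA dB dC n. inner3 dA dB dC \<psi> v = 0))"
      using setU_unextendible [OF d] by blast
  qed (rule setU_orthogonal [OF d] setU_not_spanning [OF d])+
  show "strongly_nonlocal dA dB dC (setU dA dB dC n)"
    by (rule strongly_nonlocal_shell [OF setU_outer_shell [OF d] setU_inner_self [OF d] setU_orthogonal [OF d]])
  show "card (setU dA dB dC n) = dA * dB * dC - 8 * (n + 1)"
    by (rule card_setU [OF d])
qed

end
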